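(* The 85 tie sequences with at most 9 moves give tie knots of exactly the following knot types (names from the standard Rolfsen knot table, knot types taken up to mirror image). Each tie sequence is written as its list of region letters, omitting the final $T$ and the directions (which are determined by alternation and by the last move being $C_o$). $0_1$: LRC, LCRLC, LCLRC, LRCLRC, LRCRLC, LRLCRLC, LRLCLRC, LRLRCLRC, LRLRCRLC, LRLRLCRLC, LRLRLCLRC. $3_1$: LRLC, LCRCLRC, LCRCRLC, LCLCRLC, LCLCLRC, LCRLCRLC, LCLRCLRC, LCRLCLRC, LCLRCRLC, LCRLRCLRC, LCRLRCRLC, LCLRLCRLC, LCLRLCLRC. $4_1$: LRLRC, LRCLCRLC, LRCRCLRC, LRCLCLRC, LRCRCRLC, LRCLRCLRC, LRCRLCRLC, LRCLRCRLC, LRCRLCLRC. $5_1$: LCLRLC, LCLCRCLRC, LCLCRCRLC, LCLCLCRLC, LCLCLCLRC. $5_2$: LRLRLC, LCRLRC, LRLCRCLRC, LRLCRCRLC, LRLCLCRLC, LRLCLCLRC, LCRCLCRLC, LCRCRCLRC, LCRCLCLRC, LCRCRCRLC. $6_1$: LRLRLRC, LRCRLRC. $6_2$: LRCLRLC, LCLRLRC. $6_3$: LCRLRLC. $7_1$: LCLCLRLC. $7_2$: LRLRLRLC, LCRCRLRC. $7_3$: LRLCLRLC, LCLCRLRC. $7_4$: LRLCRLRC. $7_5$: LCLRLRLC, LCRCLRLC. $7_6$: LRCRLRLC, LCRLRLRC. $7_7$: LRCLRLRC. $8_1$: LRLRLRLRC, LRCRCRLRC. $8_2$: LRCLCLRLC,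 LCLCLRLRC. $8_3$: LRLRCRLRC. $8_4$: LRLRCLRLC, LCLRCRLRC. $8_6$: LCLRLRLRC, LRCRCLRLC. $8_7$: LCRLCLRLC, LCLCRLRLC. $8_8$: LCRLRLRLC, LCRCRLRLC. $8_9$: LCLRCLRLC. $8_{11}$: LRLCLRLRC, LRCLCRLRC. $8_{12}$: LRCRLRLRC. $8_{13}$: LRLCRLRLC, LCRLCRLRC. $8_{14}$: LRCLRLRLC, LCRCLRLRC.
   Context: Tie sequences. The tie moves are $L_i,L_o,R_i,R_o,C_i,C_o$; the letter names a region (left, right, center) and the subscript a direction ($i$ = in, $o$ = out). A tie sequence is a finite list of tie moves followed by the symbol $T$ (tuck) such that: it begins with $L_i$ or $L_o$; no two consecutive moves have the same letter; directions alternate between in and out; it ends with $L_oR_iC_oT$ or $R_oL_iC_oT$. The number of moves does not count $T$. There are exactly 85 tie sequences with at most 9 moves. Tie diagrams. In the plane, the passive strand starts at a point $b$ at the bottom, runs up the "straight strand" to a point $x$, then up the left side of the "neck loop", clockwise over its top, and down its right side to a point $a$ just to the right of $x$. The active strand starts at $a$; its first move (an $L$ move) carries it leftward across the passive strand at $x$, closing the neck loop (the first crossing, counted as the topmost crossing of the straight strand). $C$ is the region inside the neck loop; $L$ and $R$ are the regions outside it to the left and right of the straight strand (the active strand never passes above the neck loop). Each further move carries the active strand from its current region to the named region, crossing the passive strand exactly once: across the straight strand between $L$ and $R$, across the left side of the neck loop between $L$ and $C$, across the right side between $R$ and $C$. An in-move means the active strand crosses over, an out-move that it crosses under. Successive crossings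 on the straight strand are placed lower and lower, and successive crossings on each side of the neck loop are placed higher and higher (farther from the first crossing), so that these moves create no self-crossing of the active strand. Tuck: if the sequence ends with $R_oL_iC_oT$, let $\ell$ be the arc of the active strand in region $R$ between the crossings of the final $R_o$ and final $L_i$. After $C_o$ the active strand leaves $C$ passing over the right side of the neck loop, above all earlier crossings there (crossing $t_1$, an $R_i$ move), then crosses $\ell$ over (crossing $t_2$) and then under (crossing $t_3$), where $t_2$ precedes $t_3$ along $\ell$ from $R_o$ to $L_i$, and then runs to $b$ with no further crossings. If the sequence ends with $L_oR_iC_oT$, interchange $L$ and $R$ in this description (so $t_1$ is an $L_i$ move). The resulting closed curve with crossing information is the tie diagram of the sequence, and the knot it represents is the tie knot of the sequence. *)

theory Defs
  imports "HOL-Combinatorics.Orbits"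
begin

section \<open>Tie sequences\<close>

datatype region = L | R | C
datatype direction = In | Out
type_synonym tie_move = "region \<times> direction"

text \<open>A tie sequence is represented by its list of moves. The symbol \<open>T\<close> that closes every tie
  sequence carries no information and is left implicit, so \<^term>\<open>length ms\<close> is the number of moves.\<close>

definition tie_sequence :: "tie_move list \<Rightarrow> bool" where
  "tie_sequence ms \<longleftrightarrow>
     ms \<noteq> [] \<and> fst (hd ms) = L \<and>
     successively (\<lambda>m m'. fst m \<noteq> fst m') ms \<and>
     successively (\<lambda>m m'. snd m \<noteq> snd m') ms \<and>
     (\<exists>ps. ms = ps @ [(L, Out), (R, In), (C, Out)] \<or> ms = ps @ [(R, Out), (L, In), (C, Out)])"

definition short_tie_sequences :: "tie_move list set" where
  "short_tie_sequences = {ms. tie_sequence ms \<and> length ms \<le> 9}"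

text \<open>Directions alternate and the last one is \<^const>\<open>Out\<close>.\<close>

definition with_directions :: "region list \<Rightarrow> tie_move list" where
  "with_directions w =
     map (\<lambda>i. (w ! i, if even (length w - 1 - i) then Out else In)) [0..<length w]"


section \<open>Knot diagrams\<close>

text \<open>An oriented knot diagram (on the sphere, up to isotopy) is represented by its signed Gauss code:
  the cyclic sequence of passages through crossings met when travelling once around the knot.
  A passage is (label of the crossing, is it the over-passage?, is the crossing positive?).
  A crossing is positive if (over direction, under direction) is a positively oriented basis of
  the plane. The empty code is the diagram without crossings.\<close>

type_synonym passage = "nat \<times> bool \<times> bool"
type_synonym gauss_code = "passage list"

definition valid_code :: "gauss_code \<Rightarrow> bool" where
  "valid_code w \<longleftrightarrow>
     distinct (map (\<lambda>(c, ov, pos). (c, ov)) w) \<and>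
     (\<forall>(c, ov, pos) \<in> set w. (c, \<not> ov, pos) \<in> set w)"

text \<open>The position of the other passage through the crossing at position \<open>k\<close>.\<close>

definition partner :: "gauss_code \<Rightarrow> nat \<Rightarrow> nat" where
  "partner w k =
     (case w ! k of (c, ov, pos) \<Rightarrow> (THE j. j < length w \<and> w ! j = (c, \<not> ov, pos)))"

text \<open>A valid code comes from a curve on a closed oriented surface, obtained by glueing a disc to
  every face of the 4-valent graph. The dart \<open>(i, fwd)\<close> is the edge leaving the crossing at position
  \<open>i\<close>, travelled along (\<open>fwd\<close>) or against the orientation of the knot. The next dart on the face to
  the left of it is found by turning left at the end of that edge; the strand met there passes from
  right to left (seen along the orientation) iff \<open>ov = pos\<close>. The surface is a sphere iff
  V - E + F = 2, where E is the length of the code and V is half of it.\<close>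

definition next_dart :: "gauss_code \<Rightarrow> nat \<times> bool \<Rightarrow> nat \<times> bool" where
  "next_dart w = (\<lambda>(i, fwd).
     let k = (if fwd then i + 1 else i + length w - 1) mod length w
     in case w ! k of (c, ov, pos) \<Rightarrow> (partner w k, fwd \<longleftrightarrow> (ov \<longleftrightarrow> pos)))"

definition faces :: "gauss_code \<Rightarrow> (nat \<times> bool) set set" where
  "faces w = orbit (next_dart w) ` ({..<length w} \<times> UNIV)"

definition planar :: "gauss_code \<Rightarrow> bool" where
  "planar w \<longleftrightarrow> w = [] \<or> card (faces w) = length w div 2 + 2"

definition knot_diagram :: "gauss_code \<Rightarrow> bool" where
  "knot_diagram w \<longleftrightarrow> valid_code w \<and> planar w"


section \<open>Knot types\<close>

definition seg :: "bool \<Rightarrow> 'a \<Rightarrow> 'a \<Rightarrow> 'a list" where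
  "seg d x y = (if d then [x, y] else [y, x])"

text \<open>Rules \<open>rotate\<close>, \<open>reverse\<close> and \<open>relabel\<close> change the base point, the orientation and the names of the
  crossings, i.e. the choices made in reading off the code of an unoriented diagram. The others
  are the Reidemeister moves. In \<open>R3\<close>, \<open>a\<close>, \<open>b\<close>, \<open>c\<close> are the crossings top/middle, top/bottom,
  middle/bottom, and \<open>p\<close>, \<open>q\<close>, \<open>r\<close> say in which order the three strands run through them. The
  conditions on the signs say that the three edges bound a triangular face; \<open>e\<close> is the orientation
  of the triangle \<open>a\<close>, \<open>b\<close>, \<open>c\<close>. In \<open>R2\<close> the bigon is a face because the signs are opposite.\<close>

inductive code_move :: "gauss_code \<Rightarrow> gauss_code \<Rightarrow> bool" where
  rotate: "code_move w (rotate1 w)"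
| reverse: "code_move w (rev w)"
| relabel: "inj_on f (fst ` set w) \<Longrightarrow> code_move w (map (\<lambda>(c, ov, pos). (f c, ov, pos)) w)"
| R1: "code_move (u @ [(c, ov, pos), (c, \<not> ov, pos)] @ v) (u @ v)"
| R2_parallel: "code_move
    (u @ [(c, ov, pos), (d, ov, \<not> pos)] @ v @ [(c, \<not> ov, pos), (d, \<not> ov, \<not> pos)] @ w)
    (u @ v @ w)"
| R2_antiparallel: "code_move
    (u @ [(c, ov, pos), (d, ov, \<not> pos)] @ v @ [(d, \<not> ov, \<not> pos), (c, \<not> ov, pos)] @ w)
    (u @ v @ w)"
| R3: "\<lbrakk>sa \<longleftrightarrow> (e \<longleftrightarrow> (p \<longleftrightarrow> q)); sb \<longleftrightarrow> (e \<longleftrightarrow> (p \<longleftrightarrow> r)); sc \<longleftrightarrow> (e \<longleftrightarrow> (q \<longleftrightarrow> r));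
    {X, Y, Z} = {seg p (a, True, sa) (b, True, sb),
                 seg q (a, False, sa) (c, True, sc),
                 seg r (b, False, sb) (c, False, sc)}\<rbrakk> \<Longrightarrow>
    code_move (u @ X @ v @ Y @ w @ Z @ x) (u @ rev X @ v @ rev Y @ w @ rev Z @ x)"

definition isotopic :: "gauss_code \<Rightarrow> gauss_code \<Rightarrow> bool" where
  "isotopic = equivclp (\<lambda>w w'. knot_diagram w \<and> knot_diagram w' \<and> code_move w w')"

definition mirror :: "gauss_code \<Rightarrow> gauss_code" where
  "mirror w = map (\<lambda>(c, ov, pos). (c, \<not> ov, \<not> pos)) w"

text \<open>The type, up to mirror image, of the unoriented knot represented by a diagram.\<close>

definition knot_type :: "gauss_code \<Rightarrow> gauss_code set" where
  "knot_type w = {w'. knot_diagram w' \<and> (isotopic w w' \<or> isotopic (mirror w) w')}"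


section \<open>Tie diagrams\<close>

datatype segment = Straight | Left_Side | Right_Side

definition region_before :: "tie_move list \<Rightarrow> nat \<Rightarrow> region" where
  "region_before ms i = (if i = 0 then R else fst (ms ! (i - 1)))"

definition crossed_segment :: "region \<Rightarrow> region \<Rightarrow> segment" where
  "crossed_segment r r' =
     (if {r, r'} = {L, R} then Straight else if {r, r'} = {L, C} then Left_Side else Right_Side)"

definition leftward :: "region \<Rightarrow> region \<Rightarrow> bool" where
  "leftward r r' \<longleftrightarrow> r' = L \<or> r = R"

text \<open>The code starts at \<open>b\<close> and follows the passive strand to \<open>a\<close>, then the active strand back to \<open>b\<close>.
  With \<open>n\<close> the number of moves, move number \<open>i\<close> (from 0) makes crossing \<open>i\<close>; \<open>t1\<close>, \<open>t2\<close>, \<open>t3\<close> are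
  \<open>n\<close>, \<open>n + 1\<close>, \<open>n + 2\<close>, and \<open>t1\<close> is treated as a further in-move. The passive strand runs upwards
  except on the right side of the neck loop, which gives the signs of crossings \<open>0, \<dots>, n\<close>.
  The arc \<open>\<ell>\<close> is the part of the active strand between crossings \<open>n - 3\<close> and \<open>n - 2\<close>. In region \<open>R\<close>
  it starts on the boundary (the straight strand or the right side of the neck loop), ends lower
  down on the straight strand, and has \<open>t1\<close> and \<open>b\<close> on its left. So the active strand crosses it from
  left to right over at \<open>t2\<close> and back under at \<open>t3\<close>: both crossings are positive. In region \<open>L\<close> left
  and right are interchanged and both are negative.\<close>

definition tie_diagram :: "tie_move list \<Rightarrow> gauss_code" where
  "tie_diagram ms =
    (let n = length ms;
         side = fst (ms ! (n - 3));
         ms' = ms @ [(side, In)];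
         segm = (\<lambda>i. crossed_segment (region_before ms' i) (fst (ms' ! i)));
         act_over = (\<lambda>i. snd (ms' ! i) = In);
         pos = (\<lambda>i. (leftward (region_before ms' i) (fst (ms' ! i)) \<longleftrightarrow> segm i = Right_Side)
                      \<longleftrightarrow> act_over i);
         active = map (\<lambda>i. (i, act_over i, pos i));
         passive = map (\<lambda>i. (i, \<not> act_over i, pos i));
         crossings_on = (\<lambda>s. filter (\<lambda>i. segm i = s) [0..<n + 1])
     in passive (rev (crossings_on Straight)) @
        passive (crossings_on Left_Side) @
        passive (rev (crossings_on Right_Side)) @
        active [0..<n - 2] @
        [(n + 1, False, side = R), (n + 2, True, side = R)] @
        active [n - 2..<n + 1] @
        [(n + 1, True, side = R), (n + 2, False, side = R)])"

definition tie_knot :: "tie_move list \<Rightarrow> gauss_code set" where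
  "tie_knot ms = knot_type (tie_diagram ms)"


section \<open>The Rolfsen knot table\<close>

text \<open>All knots needed are alternating. In the alternating diagram with Dowker-Thistlethwaite code
  \<open>d\<close>, number the passages from 1 to 2n; the odd ones pass over, and crossing \<open>k\<close> consists of the
  passages \<open>2 k - 1\<close> and \<open>d\<^sub>k\<close>. The list \<open>neg\<close> names the negative crossings.\<close>

definition dt_diagram :: "nat list \<Rightarrow> nat list \<Rightarrow> gauss_code" where
  "dt_diagram d neg =
     map (\<lambda>i. let k = (if odd i then (i + 1) div 2 else the (map_of (zip d [1..<length d + 1]) i))
              in (k, odd i, k \<notin> set neg))
       [1..<2 * length d + 1]"

text \<open>The codes \<open>d\<close> are those of the published knot tables. For each of them \<open>neg\<close> is, up to exchanging
  positive and negative (a mirror image), the only choice for which the code is planar. The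
  comments give the Conway notation.\<close>

definition rolfsen_table :: "((nat \<times> nat) \<times> gauss_code) list" where
  "rolfsen_table = [
    ((0, 1), []),
    ((3, 1), dt_diagram [4, 6, 2] []), \<comment> \<open>3\<close>
    ((4, 1), dt_diagram [4, 6, 8, 2] [2, 4]), \<comment> \<open>2 2\<close>
    ((5, 1), dt_diagram [6, 8, 10, 2, 4] []), \<comment> \<open>5\<close>
    ((5, 2), dt_diagram [4, 8, 10, 2, 6] []), \<comment> \<open>3 2\<close>
    ((6, 1), dt_diagram [4, 8, 12, 10, 2, 6] [2, 5]), \<comment> \<open>4 2\<close>
    ((6, 2), dt_diagram [4, 8, 10, 12, 2, 6] [2, 5]), \<comment> \<open>3 1 2\<close>
    ((6, 3), dt_diagram [4, 8, 10, 2, 12, 6] [3, 5, 6]), \<comment> \<open>2 1 1 2\<close>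
    ((7, 1), dt_diagram [8, 10, 12, 14, 2, 4, 6] []), \<comment> \<open>7\<close>
    ((7, 2), dt_diagram [4, 10, 14, 12, 2, 8, 6] []), \<comment> \<open>5 2\<close>
    ((7, 3), dt_diagram [6, 10, 12, 14, 2, 4, 8] []), \<comment> \<open>4 3\<close>
    ((7, 4), dt_diagram [6, 10, 12, 14, 4, 2, 8] []), \<comment> \<open>3 1 3\<close>
    ((7, 5), dt_diagram [4, 10, 12, 14, 2, 8, 6] []), \<comment> \<open>3 2 2\<close>
    ((7, 6), dt_diagram [4, 8, 12, 2, 14, 6, 10] [5, 7]), \<comment> \<open>2 2 1 2\<close>
    ((7, 7), dt_diagram [4, 8, 10, 12, 2, 14, 6] [2, 4, 5, 7]), \<comment> \<open>2 1 1 1 2\<close>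
    ((8, 1), dt_diagram [4, 10, 16, 14, 12, 2, 8, 6] [2, 6]), \<comment> \<open>6 2\<close>
    ((8, 2), dt_diagram [4, 10, 12, 14, 16, 2, 6, 8] [2, 6]), \<comment> \<open>5 1 2\<close>
    ((8, 3), dt_diagram [6, 12, 10, 16, 14, 4, 2, 8] [2, 3, 6, 7]), \<comment> \<open>4 4\<close>
    ((8, 4), dt_diagram [6, 10, 12, 16, 14, 4, 2, 8] [2, 3, 6, 7]), \<comment> \<open>4 1 3\<close>
    ((8, 6), dt_diagram [4, 10, 14, 16, 12, 2, 8, 6] [2, 6]), \<comment> \<open>3 3 2\<close>
    ((8, 7), dt_diagram [4, 10, 12, 14, 2, 16, 6, 8] [3, 4, 6, 7, 8]), \<comment> \<open>4 1 1 2\<close>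
    ((8, 8), dt_diagram [4, 8, 12, 2, 16, 14, 6, 10] [3, 5, 6, 7, 8]), \<comment> \<open>2 3 1 2\<close>
    ((8, 9), dt_diagram [6, 10, 12, 14, 16, 4, 2, 8] [2, 3, 6, 7]), \<comment> \<open>3 1 1 3\<close>
    ((8, 11), dt_diagram [4, 10, 12, 14, 16, 2, 8, 6] [2, 6]), \<comment> \<open>3 2 1 2\<close>
    ((8, 12), dt_diagram [4, 8, 14, 10, 2, 16, 6, 12] [2, 5, 6, 8]), \<comment> \<open>2 2 2 2\<close>
    ((8, 13), dt_diagram [4, 10, 12, 14, 2, 16, 8, 6] [3, 4, 6, 7, 8]), \<comment> \<open>3 1 1 1 2\<close>
    ((8, 14), dt_diagram [4, 8, 10, 14, 2, 16, 6, 12] [2, 5])] \<comment> \<open>2 2 1 1 2\<close>"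

definition rolfsen :: "nat \<Rightarrow> nat \<Rightarrow> gauss_code set" where
  "rolfsen n k = knot_type (the (map_of rolfsen_table (n, k)))"

definition sequences_of_type :: "gauss_code set \<Rightarrow> tie_move list set" where
  "sequences_of_type K = {ms \<in> short_tie_sequences. tie_knot ms = K}"

end

theory Submission
  imports Defs "HOL-Library.Numeral_Type"
begin

text \<open>The tie diagrams are carried to diagrams of the table by explicit Reidemeister moves. Moves that do not
  increase the number of crossings suffice to reach a reduced alternating diagram, which is then
  brought into the form of the table by at most one flype: a bigon is added, and its crossings are
  moved past a crossing and removed by the first Reidemeister move. That every intermediate code is
  planar is checked by counting its faces.

  The knots of the table are distinguished by their Alexander modules, evaluated at \<open>t\<close>: over a
  commutative ring in which \<open>t\<close> is a unit, every Reidemeister move extends or restricts colourings in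
  a unique way, so the scalars that make all colourings constant are an invariant. For two-bridge
  knots and the ring of integers modulo \<open>n\<close> they are the multiples of the greatest common divisor of \<open>n\<close>
  and \<open>\<Delta>(t)\<close>, where \<open>\<Delta>\<close> is the Alexander polynomial. A diagram is tested together with its mirror
  image, and \<open>t\<close> together with its inverse, which makes the orientation and the chirality
  irrelevant.\<close>


section \<open>Mirror images and isotopy\<close>

text \<open>A chain of moves only shows that a sequence gives a certain knot. That the list of
  sequences of each knot is complete follows because the certificates exhaust all 85 words and the
  27 target types are pairwise different; neither half suffices alone. Planarity cannot be skipped
  in a chain: \<open>isotopic\<close> admits only planar codes, and a chain through other codes
  would compare virtual knots.

  The obstacle is the amount of computation. Faces, moves and linear algebra are therefore
  formulated on lists and integers, where they can be evaluated, and are tied to the abstract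
  definitions by soundness lemmas.

  The Alexander polynomial is never constructed. Annihilating scalars replace it because a move
  changes the number of crossings, and so the presentation of the module of colourings, but not its
  annihilator. A modulus with six prime factors examines six residue fields at once. Requiring
  \<open>1 - t\<close> to be a unit makes the colour of an over-strand computable from the two arcs
  below it, so that two colours spread over a whole diagram.\<close>

lemma length_mirror [simp]: "length (mirror w) = length w"
  by (simp add: mirror_def)

lemma mirror_mirror [simp]: "mirror (mirror w) = w"
  by (simp add: mirror_def comp_def case_prod_unfold)

lemma mirror_simps [simp]:
  "mirror [] = []"
  "mirror ((c, ov, pos) # w) = (c, \<not> ov, \<not> pos) # mirror w"
  "mirror (v @ w) = mirror v @ mirror w"
  "mirror (rev w) = rev (mirror w)"
  "mirror (rotate1 w) = rotate1 (mirror w)"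
  by (simp_all add: mirror_def rev_map rotate1_map)

lemma mirror_seg: "mirror (seg d (a, b, c) (a', b', c')) = seg d (a, \<not> b, \<not> c) (a', \<not> b', \<not> c')"
  by (simp add: seg_def)

lemma set_mirror: "(c, ov, pos) \<in> set (mirror w) \<longleftrightarrow> (c, \<not> ov, \<not> pos) \<in> set w"
  by (force simp: mirror_def)

lemma valid_code_mirror_if:
  assumes "valid_code w"
  shows "valid_code (mirror w)"
proof -
  let ?key = "\<lambda>(c, ov, pos). (c, ov) :: nat \<times> bool"
  have "map ?key (mirror w) = map (\<lambda>(c, ov). (c, \<not> ov)) (map ?key w)"
    by (simp add: mirror_def case_prod_unfold comp_def)
  moreover have "inj_on (\<lambda>(c, ov). (c, \<not> ov)) A" for A :: "(nat \<times> bool) set"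
    by (auto simp: inj_on_def)
  ultimately have "distinct (map ?key (mirror w))"
    using assms unfolding valid_code_def by (simp only: distinct_map [of "\<lambda>(c, ov). (c, \<not> ov)"])
  moreover have "\<forall>(c, ov, pos) \<in> set (mirror w). (c, \<not> ov, pos) \<in> set (mirror w)"
    using assms by (fastforce simp: valid_code_def set_mirror)
  ultimately show ?thesis
    unfolding valid_code_def by blast
qed

lemma valid_code_mirror [simp]: "valid_code (mirror w) \<longleftrightarrow> valid_code w"
  using valid_code_mirror_if [of w] valid_code_mirror_if [of "mirror w"] by auto

lemma nth_mirror:
  "k < length w \<Longrightarrow> mirror w ! k = (case w ! k of (c, ov, pos) \<Rightarrow> (c, \<not> ov, \<not> pos))"
  by (simp add: mirror_def)

lemma partner_mirror:
  assumes "k < length w"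
  shows "partner (mirror w) k = partner w k"
proof -
  obtain c ov pos where k: "w ! k = (c, ov, pos)"
    by (cases "w ! k") auto
  have "j < length (mirror w) \<and> mirror w ! j = (c, \<not> \<not> ov, \<not> pos) \<longleftrightarrow>
    j < length w \<and> w ! j = (c, \<not> ov, pos)" for j
    by (cases "w ! j") (auto simp: nth_mirror)
  then show ?thesis
    by (simp add: partner_def nth_mirror assms k)
qed

text \<open>A mirror image flips \<open>ov\<close> and \<open>pos\<close> together. A turn depends
  on them only through \<open>ov = pos\<close> and the partner, so the curve on the surface is the
  same.\<close>

lemma next_dart_mirror:
  assumes "w \<noteq> []"
  shows "next_dart (mirror w) = next_dart w"
proof
  fix d
  obtain i :: nat and fwd :: bool where d: "d = (i, fwd)"
    by (cases d) auto
  have k: "(if fwd then i + 1 else i + length w - 1) mod length w < length w"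
    using assms by simp
  show "next_dart (mirror w) d = next_dart w d"
    unfolding d next_dart_def prod.case length_mirror Let_def partner_mirror [OF k] nth_mirror [OF k]
    by (auto split: prod.split)
qed

lemma planar_mirror [simp]: "planar (mirror w) \<longleftrightarrow> planar w"
  by (cases "w = []") (simp_all add: planar_def faces_def next_dart_mirror, simp add: mirror_def)

lemma knot_diagram_mirror [simp]: "knot_diagram (mirror w) \<longleftrightarrow> knot_diagram w"
  by (simp add: knot_diagram_def)

lemma code_move_mirror:
  assumes "code_move w w'"
  shows "code_move (mirror w) (mirror w')"
  using assms
proof cases
  case (relabel f)
  have "mirror w' = map (\<lambda>(c, ov, pos). (f c, ov, pos)) (mirror w)"
    by (simp add: relabel mirror_def case_prod_unfold comp_def)
  moreover have "fst ` set (mirror w) = fst ` set w"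
    by (simp add: mirror_def case_prod_unfold image_image)
  ultimately show ?thesis
    using code_move.relabel [of f "mirror w"] relabel(2) by simp
next
  case (R1 u c ov pos v)
  then show ?thesis
    using code_move.R1 [of "mirror u" c "\<not> ov" "\<not> pos" "mirror v"] by simp
next
  case (R2_parallel u c ov pos d v w)
  then show ?thesis
    using code_move.R2_parallel [of "mirror u" c "\<not> ov" "\<not> pos" d "mirror v" "mirror w"] by simp
next
  case (R2_antiparallel u c ov pos d v w)
  then show ?thesis
    using code_move.R2_antiparallel [of "mirror u" c "\<not> ov" "\<not> pos" d "mirror v" "mirror w"] by simp
next
  case (R3 sa e p q sb r sc X Y Z a b c u v w x)
  have "mirror ` {X, Y, Z} = {seg p (a, False, \<not> sa) (b, False, \<not> sb),
                 seg q (a, True, \<not> sa) (c, False, \<not> sc),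
                 seg r (b, True, \<not> sb) (c, True, \<not> sc)}"
    unfolding R3(6) by (simp add: mirror_seg)
  \<comment> \<open>The mirror image exchanges the top and the bottom strand, hence also \<open>a\<close> and \<open>c\<close>.\<close>
  then have XYZ: "{mirror X, mirror Y, mirror Z} = {seg (\<not> r) (c, True, \<not> sc) (b, True, \<not> sb),
                 seg (\<not> q) (c, False, \<not> sc) (a, True, \<not> sa),
                 seg (\<not> p) (b, False, \<not> sb) (a, False, \<not> sa)}"
    by (auto simp: seg_def)
  show ?thesis
    unfolding R3(1,2) mirror_simps
    by (rule code_move.R3 [of "\<not> sc" "\<not> e" _ _ "\<not> sb" _ "\<not> sa", OF _ _ _ XYZ]) (auto simp: R3)
qed (auto intro: code_move.intros)

lemma isotopic_refl [simp]: "isotopic w w"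
  by (simp add: isotopic_def)

lemma isotopic_sym: "isotopic w w' \<Longrightarrow> isotopic w' w"
  unfolding isotopic_def by (rule equivclp_sym)

lemma isotopic_trans [trans]: "isotopic w w' \<Longrightarrow> isotopic w' w'' \<Longrightarrow> isotopic w w''"
  unfolding isotopic_def by (rule equivclp_trans)

lemma isotopic_move: "knot_diagram w \<Longrightarrow> knot_diagram w' \<Longrightarrow> code_move w w' \<Longrightarrow> isotopic w w'"
  unfolding isotopic_def by (rule r_into_equivclp) blast

lemma isotopic_mirror:
  assumes "isotopic w w'"
  shows "isotopic (mirror w) (mirror w')"
  using assms unfolding isotopic_def
proof (induction rule: equivclp_induct)
  case (step y z)
  then have "isotopic (mirror y) (mirror z)"
    using isotopic_move [OF _ _ code_move_mirror] isotopic_sym by auto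
  then show ?case
    using step.IH isotopic_trans unfolding isotopic_def by blast
qed simp

lemma knot_type_eq_if_isotopic:
  assumes "isotopic w w'"
  shows "knot_type w = knot_type w'"
  using assms isotopic_mirror [OF assms] isotopic_sym isotopic_trans
  unfolding knot_type_def by blast

lemma knot_type_mirror: "knot_type (mirror w) = knot_type w"
  by (auto simp: knot_type_def)

section \<open>Alexander colourings\<close>

text \<open>\<open>u\<close> stands for the inverse of \<open>t\<close>. A colouring gives every arc an element of the ring, so that passing
  under an arc of colour \<open>y\<close> changes the colour \<open>x\<close> of the strand to \<open>act t u s x y\<close>. It is encoded by the
  colour \<open>x\<close> at the base point and the function \<open>g\<close> that maps a crossing to the colour of its
  over-strand. The scalars \<open>d\<close> that make all colourings constant form the annihilator of the reduced
  module of colourings.\<close>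

definition act :: "'a::comm_ring_1 \<Rightarrow> 'a \<Rightarrow> bool \<Rightarrow> 'a \<Rightarrow> 'a \<Rightarrow> 'a" where
  "act t u s x y = (if s then t * x + (1 - t) * y else u * x + (1 - u) * y)"

primrec travel :: "'a::comm_ring_1 \<Rightarrow> 'a \<Rightarrow> (nat \<Rightarrow> 'a) \<Rightarrow> gauss_code \<Rightarrow> 'a \<Rightarrow> 'a \<Rightarrow> bool" where
  "travel t u g [] x y \<longleftrightarrow> x = y"
| "travel t u g (p # w) x y \<longleftrightarrow>
     (case p of (c, ov, pos) \<Rightarrow>
        if ov then x = g c \<and> travel t u g w x y else travel t u g w (act t u pos x (g c)) y)"

definition kills :: "'a::comm_ring_1 \<Rightarrow> 'a \<Rightarrow> 'a \<Rightarrow> gauss_code \<Rightarrow> bool" where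
  "kills t u d w \<longleftrightarrow>
     (\<forall>x g. travel t u g w x x \<longrightarrow> (\<forall>c \<in> fst ` set w. d * (g c - x) = 0))"

section \<open>Algebra of the colouring action\<close>

lemma act_same [simp]: "act t u s x x = x"
  by (simp add: act_def algebra_simps)

lemma act_swap: "act u t s = act t u (\<not> s)"
  by (auto simp: act_def fun_eq_iff)

lemma act_cancel:
  assumes "t * u = 1"
  shows "act t u s (act t u (\<not> s) x y) y = x"
proof -
  have "act t u s (act t u (\<not> s) x y) y = (t * u) * x + (1 - t * u) * y"
    by (simp add: act_def algebra_simps)
  then show ?thesis
    using assms by simp
qed

text \<open>The law behind the third Reidemeister move.\<close>

lemma act_distrib: "act t u s (act t u s' x z) (act t u s' y z) = act t u s' (act t u s x y) z"
  by (simp add: act_def algebra_simps)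

lemma kill_act:
  fixes d :: "'a::comm_ring_1"
  assumes "d * (x - a) = 0" "d * (y - a) = 0"
  shows "d * (act t u s x y - a) = 0"
proof -
  have "d * (act t u s x y - a) =
    (if s then t * (d * (x - a)) + (1 - t) * (d * (y - a))
     else u * (d * (x - a)) + (1 - u) * (d * (y - a)))"
    by (simp add: act_def algebra_simps)
  then show ?thesis using assms by simp
qed

lemma travel_append:
  "travel t u g (v @ w) x y \<longleftrightarrow> (\<exists>z. travel t u g v x z \<and> travel t u g w z y)"
  by (induction v arbitrary: x) auto

lemma travel_cong:
  "(\<And>c. c \<in> fst ` set w \<Longrightarrow> g c = g' c) \<Longrightarrow> travel t u g w x y \<longleftrightarrow> travel t u g' w x y"
  by (induction w arbitrary: x) (auto split: prod.splits)

lemma travel_upd [simp]: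
  "c \<notin> fst ` set w \<Longrightarrow> travel t u (g(c := z)) w x y \<longleftrightarrow> travel t u g w x y"
  by (rule travel_cong) auto

text \<open>The elements whose difference from \<open>a\<close> is annihilated by \<open>d\<close>
  are closed under \<open>act\<close>. This relates the colours at different places of a code, for
  instance at two base points.\<close>

lemma travel_kill:
  assumes "travel t u g w x y" "\<And>c. c \<in> fst ` set w \<Longrightarrow> d * (g c - a) = 0" "d * (x - a) = 0"
  shows "d * (y - a) = 0"
  using assms
  by (induction w arbitrary: x) (auto split: prod.splits if_splits simp: kill_act)

lemma travel_relabel:
  "travel t u g (map (\<lambda>(c, ov, pos). (f c, ov, pos)) w) x y \<longleftrightarrow> travel t u (g \<circ> f) w x y"
  by (induction w arbitrary: x) (auto split: prod.splits)

text \<open>Going backwards undoes each under-passage, and the inverse of an action is the action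
  with \<open>t\<close> and \<open>u\<close> exchanged. The signs of the crossings do not depend on
  the orientation.\<close>

lemma travel_rev:
  assumes "t * u = 1"
  shows "travel t u g (rev w) x y \<longleftrightarrow> travel u t g w y x"
proof (induction w arbitrary: x y)
  case (Cons p w)
  obtain c ov pos where p: "p = (c, ov, pos)"
    by (cases p) auto
  have *: "act t u pos z (g c) = y \<longleftrightarrow> z = act u t pos y (g c)" for z
    using act_cancel [OF assms, of pos] act_cancel [OF assms, of "\<not> pos"]
    by (auto simp: act_swap [of u t])
  show ?case
    by (auto simp: travel_append Cons.IH p *)
qed auto

section \<open>Invariance of the annihilator under the moves\<close>

lemma kills_rev: "t * u = 1 \<Longrightarrow> kills t u d (rev w) \<longleftrightarrow> kills u t d w"
  by (simp add: kills_def travel_rev)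

lemma kills_rotate1_if:
  assumes "t * u = 1" "kills t u d w"
  shows "kills t u d (rotate1 w)"
proof (cases w)
  case (Cons p v)
  obtain c ov pos where p: "p = (c, ov, pos)"
    by (cases p) auto
  show ?thesis
    unfolding kills_def
  proof (intro allI impI ballI)
    fix x g c'
    assume tr: "travel t u g (rotate1 w) x x" and c': "c' \<in> fst ` set (rotate1 w)"
    then obtain z where z: "travel t u g v x z" "travel t u g [p] z x"
      by (auto simp: Cons travel_append)
    then have "travel t u g w z z"
      by (auto simp: Cons p split: if_splits)
    then have *: "d * (g a - z) = 0" if "a \<in> fst ` set w" for a
      using assms(2) that unfolding kills_def by blast
    have "d * (x - z) = 0"
      using travel_kill [OF z(2), of d z] * by (auto simp: Cons)
    moreover have "d * (g c' - z) = 0"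
      using * c' by simp
    ultimately show "d * (g c' - x) = 0"
      by (simp add: algebra_simps)
  qed
qed (use assms in simp)

lemma kills_rotate1:
  assumes "t * u = 1"
  shows "kills t u d (rotate1 w) \<longleftrightarrow> kills t u d w"
proof
  assume k: "kills t u d (rotate1 w)"
  \<comment> \<open>Rotation has finite order, so the converse follows from the direction already
    known: \<open>length w - 1\<close> further rotations of \<open>rotate1 w\<close> return to
    \<open>w\<close>.\<close>
  have "kills t u d ((rotate1 ^^ n) (rotate1 w))" for n
    by (induction n) (auto intro: kills_rotate1_if [OF assms] k)
  from this [of "length w - 1"] show "kills t u d w"
    by (cases w) (simp_all add: rotate_def [symmetric] del: rotate1.simps
        flip: rotate1_rotate_swap rotate_Suc)
qed (rule kills_rotate1_if [OF assms])

lemma kills_relabel: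
  assumes "inj_on f (fst ` set w)"
  shows "kills t u d (map (\<lambda>(c, ov, pos). (f c, ov, pos)) w) \<longleftrightarrow> kills t u d w"
proof
  assume k: "kills t u d w"
  show "kills t u d (map (\<lambda>(c, ov, pos). (f c, ov, pos)) w)"
    unfolding kills_def travel_relabel
  proof (intro allI impI ballI)
    fix x g c'
    assume tr: "travel t u (g \<circ> f) w x x"
      and "c' \<in> fst ` set (map (\<lambda>(c, ov, pos). (f c, ov, pos)) w)"
    then obtain c where "c \<in> fst ` set w" "c' = f c"
      by force
    moreover from this have "d * ((g \<circ> f) c - x) = 0"
      using k tr unfolding kills_def by blast
    ultimately show "d * (g c' - x) = 0"
      by simp
  qed
next
  assume k: "kills t u d (map (\<lambda>(c, ov, pos). (f c, ov, pos)) w)"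
  show "kills t u d w"
    unfolding kills_def
  proof (intro allI impI ballI)
    fix x g c
    assume tr: "travel t u g w x x" and c: "c \<in> fst ` set w"
    \<comment> \<open>\<open>f\<close> is invertible on the labels that occur, and a journey along
      \<open>w\<close> sees no others.\<close>
    define h where "h = g \<circ> the_inv_into (fst ` set w) f"
    have h: "h (f a) = g a" if "a \<in> fst ` set w" for a
      using that assms by (simp add: h_def the_inv_into_f_f)
    have "travel t u (h \<circ> f) w x x"
      using tr travel_cong [of w "h \<circ> f" g t u x x] h by simp
    moreover have "f c \<in> fst ` set (map (\<lambda>(c, ov, pos). (f c, ov, pos)) w)"
      using c by force
    ultimately have "d * (h (f c) - x) = 0"
      using k unfolding kills_def travel_relabel by blast
    then show "d * (g c - x) = 0"
      using h c by simp
  qed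
qed

lemma distinct_keys:
  assumes "valid_code l" "mset l = mset l'"
  shows "distinct (map (\<lambda>(c, ov, pos). (c, ov)) l')"
proof -
  let ?key = "\<lambda>(c, ov, pos). (c, ov) :: nat \<times> bool"
  have "mset (map ?key l) = mset (map ?key l')"
    using assms(2) by (metis mset_map)
  then show ?thesis
    using assms(1) unfolding valid_code_def by (metis mset_eq_imp_distinct_iff)
qed

text \<open>Both passages through \<open>c\<close> are used up by \<open>x\<close>. Hence
  recolouring \<open>c\<close> in a move on \<open>x\<close> does not disturb the journey through
  the rest of the code.\<close>

lemma fresh_label:
  assumes "valid_code l" "mset l = mset (x @ y)" "(c, True, p) \<in> set x" "(c, False, q) \<in> set x"
  shows "c \<notin> fst ` set y"
proof
  let ?key = "\<lambda>(c, ov, pos). (c, ov) :: nat \<times> bool"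
  have "distinct (map ?key (x @ y))"
    by (rule distinct_keys [OF assms(1,2)])
  then have disj: "?key ` set x \<inter> ?key ` set y = {}"
    by simp
  assume "c \<in> fst ` set y"
  then obtain ov r where "(c, ov, r) \<in> set y"
    by auto
  then have "(c, ov) \<in> ?key ` set y"
    by force
  moreover have "(c, ov) \<in> ?key ` set x"
    using assms(3,4) by (cases ov) force+
  ultimately show False
    using disj by blast
qed

text \<open>In a kink the strand passes under itself. Since \<open>act\<close> fixes equal colours
  and is injective in its first argument, the crossing must have the colour of the strand, which
  leaves unchanged.\<close>

lemma kills_R1:
  assumes "valid_code (v @ [(c, ov, pos), (c, \<not> ov, pos)] @ w)" (is "valid_code ?l") and tu: "t * u = 1"
  shows "kills t u d ?l \<longleftrightarrow> kills t u d (v @ w)"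
proof
  have c: "c \<notin> fst ` set (v @ w)"
    by (rule fresh_label [OF assms(1), of "[(c, ov, pos), (c, \<not> ov, pos)]" _ _ pos pos]; cases ov) auto
  have inj: "act t u pos z y = y \<longleftrightarrow> z = y" for y z
    using act_cancel [OF tu, of "\<not> pos" z y] by auto
  {
    assume k: "kills t u d ?l"
    show "kills t u d (v @ w)"
      unfolding kills_def
    proof (intro allI impI ballI)
      fix x g c'
      assume tr: "travel t u g (v @ w) x x" and c': "c' \<in> fst ` set (v @ w)"
      then obtain z where z: "travel t u g v x z" "travel t u g w z x"
        by (auto simp: travel_append)
      let ?g = "g(c := z)"
      have "travel t u ?g v x z" "travel t u ?g w z x"
        using z c by (simp_all add: image_Un)
      moreover have "travel t u ?g [(c, ov, pos), (c, \<not> ov, pos)] z z"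
        by simp
      ultimately have "travel t u ?g ?l x x"
        unfolding travel_append by blast
      moreover have "c' \<in> fst ` set ?l"
        using c' by auto
      ultimately have "d * (?g c' - x) = 0"
        using k unfolding kills_def by blast
      then show "d * (g c' - x) = 0"
        using c c' by (auto split: if_splits)
    qed
  }
  assume k: "kills t u d (v @ w)"
  show "kills t u d ?l"
    unfolding kills_def
  proof (intro allI impI ballI)
    fix x g c'
    assume tr: "travel t u g ?l x x" and c': "c' \<in> fst ` set ?l"
    then obtain z where z: "travel t u g v x z" "travel t u g w z x" "g c = z"
      by (auto simp: travel_append inj split: if_splits)
    then have "travel t u g (v @ w) x x"
      unfolding travel_append by blast
    then have *: "d * (g a - x) = 0" if "a \<in> fst ` set (v @ w)" for a
      using k that unfolding kills_def by blast
    moreover have "d * (z - x) = 0"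
      using travel_kill [OF z(1), of d x] * by auto
    ultimately show "d * (g c' - x) = 0"
      using c' z(3) by auto
  qed
qed

lemma kills_R2:
  assumes "valid_code (v @ [(c, ov, pos), (d, ov, \<not> pos)] @ v' @ y @ w)" (is "valid_code ?l")
    and y: "y = [(c, \<not> ov, pos), (d, \<not> ov, \<not> pos)] \<or> y = [(d, \<not> ov, \<not> pos), (c, \<not> ov, pos)]"
    and tu: "t * u = 1"
  shows "kills t u k ?l \<longleftrightarrow> kills t u k (v @ v' @ w)"
proof
  let ?x = "[(c, ov, pos), (d, ov, \<not> pos)]"
  have "mset ?l = mset ((?x @ y) @ (v @ v' @ w))"
    by simp
  note fresh = fresh_label [OF assms(1) this]
  have c: "c \<notin> fst ` set (v @ v' @ w)" "d \<notin> fst ` set (v @ v' @ w)"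
    by (rule fresh [of _ pos pos] fresh [of _ "\<not> pos" "\<not> pos"]; use y in \<open>cases ov; auto\<close>)+
  have cancel: "act t u pos (act t u (\<not> pos) a b) b = a" "act t u (\<not> pos) (act t u pos a b) b = a" for a b
    using act_cancel [OF tu, of pos] act_cancel [OF tu, of "\<not> pos"] by auto
  {
    assume k: "kills t u k ?l"
    show "kills t u k (v @ v' @ w)"
      unfolding kills_def
    proof (intro allI impI ballI)
      fix x g c'
      assume tr: "travel t u g (v @ v' @ w) x x" and c': "c' \<in> fst ` set (v @ v' @ w)"
      then obtain z z' where z: "travel t u g v x z" "travel t u g v' z z'" "travel t u g w z' x"
        by (auto simp: travel_append)
      \<comment> \<open>Both crossings get the colour of their common over-strand, which is the
        strand met first or second according to \<open>ov\<close>. The under-strand is acted on with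
        opposite signs and leaves with its old colour.\<close>
      let ?z = "if ov then z else z'"
      let ?g = "g(c := ?z, d := ?z)"
      have "travel t u ?g v x z" "travel t u ?g v' z z'" "travel t u ?g w z' x"
        using z c by (simp_all add: image_Un)
      moreover have "travel t u ?g ?x z z" "travel t u ?g y z' z'"
        using y by (auto simp: cancel)
      ultimately have "travel t u ?g ?l x x"
        unfolding travel_append by blast
      moreover have "c' \<in> fst ` set ?l"
        using c' by auto
      ultimately have "k * (?g c' - x) = 0"
        using k unfolding kills_def by blast
      then show "k * (g c' - x) = 0"
        using c c' by (auto split: if_splits)
    qed
  }
  assume k: "kills t u k (v @ v' @ w)"
  show "kills t u k ?l"
    unfolding kills_def
  proof (intro allI impI ballI)
    fix x g c'
    assume tr: "travel t u g ?l x x" and c': "c' \<in> fst ` set ?l"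
    then obtain z1 z2 z3 z4 where z: "travel t u g v x z1" "travel t u g ?x z1 z2"
      "travel t u g v' z2 z3" "travel t u g y z3 z4" "travel t u g w z4 x"
      unfolding travel_append by blast
    have g: "g c = g d" "g c = z1 \<or> g c = z3" "z2 = z1" "z4 = z3"
      using z(2,4) y by (auto simp: cancel split: if_splits)
    then have "travel t u g (v @ v' @ w) x x"
      using z unfolding travel_append by blast
    then have *: "k * (g a - x) = 0" if "a \<in> fst ` set (v @ v' @ w)" for a
      using k that unfolding kills_def by blast
    moreover have z1: "k * (z1 - x) = 0"
      using travel_kill [OF z(1), of k x] * by auto
    moreover have "k * (z3 - x) = 0"
      using travel_kill [OF z(3), of k x] * z1 g by auto
    ultimately show "k * (g c' - x) = 0"
      using c' g y by auto
  qed
qed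


text \<open>Rule \<open>R3\<close> gives the order of the three segments only through an equality of
  sets. As the segments are distinct, summing \<open>mset\<close> over the set counts each of them
  once.\<close>

lemma mset_three_eq:
  assumes "{X, Y, Z} = {T, M, B::'a list}" "T \<noteq> M" "T \<noteq> B" "M \<noteq> B"
  shows "mset X + mset Y + mset Z = mset T + mset M + mset B"
proof -
  have "card {X, Y, Z} = 3"
    using assms by simp
  then have "X \<noteq> Y" "X \<noteq> Z" "Y \<noteq> Z"
    by (auto simp: card_insert_if split: if_splits)
  moreover have "sum mset {X, Y, Z} = sum mset {T, M, B}"
    using assms(1) by simp
  ultimately show ?thesis
    using assms(2-) by (simp add: ac_simps)
qed

lemma rev_seg: "rev (seg p x y) = seg (\<not> p) x y"
  by (simp add: seg_def)

text \<open>All colours outside the triangle stay. Only the piece of the middle strand that runs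
  over the bottom strand moves to the other side of the top strand, so only the colour at
  \<open>c\<close> changes.\<close>

lemma kills_R3_if:
  assumes valid: "valid_code (u' @ X @ v @ Y @ w @ Z @ x)" (is "valid_code ?l") and tu: "t * u = 1"
    and sa: "sa \<longleftrightarrow> (e \<longleftrightarrow> (p \<longleftrightarrow> q))" and sb: "sb \<longleftrightarrow> (e \<longleftrightarrow> (p \<longleftrightarrow> r))"
    and XYZ: "{X, Y, Z} = {seg p (a, True, sa) (b, True, sb),
                 seg q (a, False, sa) (c, True, sc),
                 seg r (b, False, sb) (c, False, sc)}" (is "_ = {?T, ?M, ?B}")
    and kills: "kills t u d (u' @ rev X @ v @ rev Y @ w @ rev Z @ x)" (is "kills t u d ?l'")
  shows "kills t u d ?l"
  unfolding kills_def
proof (intro allI impI ballI)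
  fix y g c'
  assume tr: "travel t u g ?l y y" and c': "c' \<in> fst ` set ?l"
  have "?T \<noteq> ?M" "?T \<noteq> ?B" "?M \<noteq> ?B"
    by (auto simp: seg_def)
  then have "mset X + mset Y + mset Z = mset ?T + mset ?M + mset ?B"
    by (rule mset_three_eq [OF XYZ])
  then have perm: "mset ?l = mset ((?T @ ?M @ ?B) @ (u' @ v @ w @ x))"
    by (simp add: ac_simps)
  note fresh = fresh_label [OF valid this]
  have c: "c \<notin> fst ` set (u' @ v @ w @ x)"
    by (rule fresh [of _ sc sc]) (auto simp: seg_def)
  have ac: "a \<noteq> c" "b \<noteq> c"
    using distinct_keys [OF valid perm] by (auto simp: seg_def split: if_splits)
  \<comment> \<open>With \<open>q\<close> the middle strand reaches \<open>c\<close> after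
    \<open>a\<close>, so the action of sign \<open>sa\<close> is undone in the new colour. Otherwise
    it reaches \<open>c\<close> first and is now acted on before it gets there.\<close>
  let ?s = "sa \<longleftrightarrow> \<not> q"
  let ?g = "g(c := act t u ?s (g c) (g a))"
  have segs: "s \<in> {?T, ?M, ?B}" if "s \<in> {X, Y, Z}" for s
    using that XYZ by blast
  have XYZ_tr: "\<exists>y z. travel t u g s y z" if "s \<in> {X, Y, Z}" for s
    using that tr unfolding travel_append by blast
  moreover have "?T \<in> {X, Y, Z}"
    using XYZ by blast
  ultimately have ab: "g a = g b"
    by (force simp: seg_def split: if_splits)
  note cancel = act_cancel [OF tu, of True, simplified] act_cancel [OF tu, of False, simplified]
  have flip: "travel t u ?g (rev s) y z" if s: "s \<in> {X, Y, Z}" and tr: "travel t u g s y z" for s y z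
  proof -
    consider "s = ?T" | "s = ?M" | "s = ?B"
      using segs [OF s] by blast
    then show ?thesis
    proof cases
      case 1
      then show ?thesis
        using tr ac by (auto simp: seg_def split: if_splits)
    next
      case 2
      then show ?thesis
        using tr ac
        by (cases q; cases sa) (auto simp: seg_def cancel)
    next
      case 3
      \<comment> \<open>The bottom strand now meets the top and the middle strand in the opposite
        order. Self-distributivity gives it the same final colour, because the middle colour has
        been acted on by the top colour as well.\<close>
      have distrib: "act t u s' (act t u sc y m) k = act t u sc (act t u s' y k) (act t u s' m k)" for s' m k
        by (simp add: act_distrib)
      show ?thesis
        using tr ac 3 sa sb
        by (cases r; cases "e \<longleftrightarrow> p"; cases q) (auto simp: seg_def cancel distrib ab)
    qed
  qed
  have "travel t u ?g ?l' y y"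
    using tr flip c unfolding travel_append
    by (simp add: image_Un) blast
  then have *: "d * (?g k - y) = 0" if "k \<in> fst ` set ?l'" for k
    using kills that unfolding kills_def by blast
  have set_eq: "set ?l' = set ?l" and set_l: "set ?l = set ?T \<union> set ?M \<union> set ?B \<union> set (u' @ v @ w @ x)"
    using mset_eq_setD [OF perm] by auto
  have abc: "a \<in> fst ` set ?l'" "c \<in> fst ` set ?l'"
    unfolding set_eq set_l by (force simp: seg_def)+
  show "d * (g c' - y) = 0"
  proof (cases "c' = c")
    case True
    have "g c = act t u (\<not> ?s) (?g c) (?g a)"
      using ac act_cancel [OF tu, of "\<not> ?s" "g c" "g a"] by simp
    then show ?thesis
      using kill_act [of d "?g c" y "?g a" t u "\<not> ?s"] * abc True by metis
  next
    case False
    then show ?thesis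
      using * [of c'] c' set_eq by simp
  qed
qed

text \<open>Reversing the segments negates \<open>p\<close>, \<open>q\<close> and \<open>r\<close>
  together, which leaves the sign conditions true. The move is thus its own inverse and one
  implication is enough.\<close>

lemma kills_R3:
  assumes "valid_code (u' @ X @ v @ Y @ w @ Z @ x)" (is "valid_code ?l")
    and "valid_code (u' @ rev X @ v @ rev Y @ w @ rev Z @ x)" (is "valid_code ?l'")
    and tu: "t * u = 1"
    and sa: "sa \<longleftrightarrow> (e \<longleftrightarrow> (p \<longleftrightarrow> q))" and sb: "sb \<longleftrightarrow> (e \<longleftrightarrow> (p \<longleftrightarrow> r))"
    and XYZ: "{X, Y, Z} = {seg p (a, True, sa) (b, True, sb),
                 seg q (a, False, sa) (c, True, sc),
                 seg r (b, False, sb) (c, False, sc)}"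
  shows "kills t u d ?l \<longleftrightarrow> kills t u d ?l'"
proof
  have "rev ` {X, Y, Z} = {seg (\<not> p) (a, True, sa) (b, True, sb),
                 seg (\<not> q) (a, False, sa) (c, True, sc),
                 seg (\<not> r) (b, False, sb) (c, False, sc)}"
    unfolding XYZ by (simp add: rev_seg)
  then have rev: "{rev X, rev Y, rev Z} = {seg (\<not> p) (a, True, sa) (b, True, sb),
                 seg (\<not> q) (a, False, sa) (c, True, sc),
                 seg (\<not> r) (b, False, sb) (c, False, sc)}"
    by simp
  assume "kills t u d ?l"
  then show "kills t u d ?l'"
    by (intro kills_R3_if [OF assms(2) tu _ _ rev, of e]) (simp_all add: sa sb)
qed (rule kills_R3_if [OF assms(1) tu sa sb XYZ])

text \<open>Reversing the orientation exchanges \<open>t\<close> and \<open>u\<close>.\<close>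

definition kills_both :: "'a::comm_ring_1 \<Rightarrow> 'a \<Rightarrow> 'a \<Rightarrow> gauss_code \<Rightarrow> bool" where
  "kills_both t u d w \<longleftrightarrow> kills t u d w \<and> kills u t d w"

lemma kills_both_move:
  assumes move: "code_move w w'" and valid: "valid_code w" "valid_code w'" and tu: "t * u = 1"
  shows "kills_both t u d w \<longleftrightarrow> kills_both t u d w'"
proof -
  have ut: "u * t = 1"
    using tu by (simp add: mult.commute)
  show ?thesis
    using move
  proof cases
    case rotate
    then show ?thesis
      by (simp add: kills_both_def kills_rotate1 [OF tu] kills_rotate1 [OF ut])
  next
    case reverse
    then show ?thesis
      by (auto simp: kills_both_def kills_rev [OF tu] kills_rev [OF ut])
  next
    case relabel
    then show ?thesis
      by (simp only: kills_both_def kills_relabel)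
  next
    case R1
    show ?thesis
      using kills_R1 [OF _ tu] kills_R1 [OF _ ut] valid(1) unfolding kills_both_def R1 by blast
  next
    case (R2_parallel v c ov pos d v' w'')
    show ?thesis
      using kills_R2 [OF _ _ tu] kills_R2 [OF _ _ ut] valid(1)
      unfolding kills_both_def R2_parallel by blast
  next
    case (R2_antiparallel v c ov pos d v' w'')
    show ?thesis
      using kills_R2 [OF _ _ tu] kills_R2 [OF _ _ ut] valid(1)
      unfolding kills_both_def R2_antiparallel by blast
  next
    case (R3 sa e p q sb r sc X Y Z a b c u' v w'' x)
    show ?thesis
      using kills_R3 [OF _ _ tu R3(3,4,6)] kills_R3 [OF _ _ ut R3(3,4,6)] valid
      unfolding kills_both_def R3(1,2) by blast
  qed
qed

lemma kills_both_isotopic: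
  assumes "isotopic w w'" "t * u = 1"
  shows "kills_both t u d w \<longleftrightarrow> kills_both t u d w'"
  using assms(1) unfolding isotopic_def
  by (induction rule: equivclp_induct)
     (use assms(2) kills_both_move knot_diagram_def in \<open>auto, blast+\<close>)

section \<open>Checking diagrams and Reidemeister moves\<close>

subsection \<open>Computing the faces\<close>

text \<open>Functions that are to be evaluated by \<open>code_simp\<close> are defined by pattern matching on tuples:
  the simplifier would evaluate the branches of a \<open>case\<close> expression on a tuple symbolically.\<close>

fun pos_of :: "nat \<Rightarrow> bool \<Rightarrow> gauss_code \<Rightarrow> nat" where
  "pos_of c ov [] = 0"
| "pos_of c ov ((c', ov', _) # w) =
     (if ov' = ov then (if c' = c then 0 else Suc (pos_of c ov w)) else Suc (pos_of c ov w))"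

lemma pos_of_nth:
  "distinct (map (\<lambda>(c, ov, pos). (c, ov)) w) \<Longrightarrow> j < length w \<Longrightarrow> w ! j = (c, ov, pos) \<Longrightarrow> pos_of c ov w = j"
proof (induction w arbitrary: j)
  case (Cons p w)
  show ?case
  proof (cases j)
    case (Suc i)
    then have i: "i < length w" "w ! i = (c, ov, pos)"
      using Cons.prems by auto
    then have "(c, ov, pos) \<in> set w"
      by (metis nth_mem)
    then show ?thesis
      using Cons.prems Cons.IH [OF _ i] Suc by (cases p) force
  qed (use Cons.prems in auto)
qed simp

lemma partner_eq_pos_of:
  assumes valid: "valid_code w" and k: "k < length w" "w ! k = (c, ov, pos)"
  shows "partner w k = pos_of c (\<not> ov) w" and "partner w k < length w"
proof -
  have "(c, \<not> ov, pos) \<in> set w"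
    using valid k nth_mem [OF k(1)] unfolding valid_code_def by auto
  then obtain j where j: "j < length w" "w ! j = (c, \<not> ov, pos)"
    by (auto simp: in_set_conv_nth)
  have eq: "i = pos_of c (\<not> ov) w" if "i < length w" "w ! i = (c, \<not> ov, pos)" for i
    using valid pos_of_nth [OF _ that] unfolding valid_code_def by simp
  have "(THE i. i < length w \<and> w ! i = (c, \<not> ov, pos)) = j"
    using j eq by (intro the_equality) auto
  then show "partner w k = pos_of c (\<not> ov) w" "partner w k < length w"
    using j eq by (auto simp: partner_def k(2))
qed

fun dart_entry :: "gauss_code \<Rightarrow> passage \<Rightarrow> nat \<times> bool" where
  "dart_entry w (c, ov, pos) = (pos_of c (\<not> ov) w, ov = pos)"

text \<open>The partner and the test \<open>ov = pos\<close> do not depend on the direction of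
  arrival, so one search per passage serves both directions.\<close>

definition dart_table :: "gauss_code \<Rightarrow> (nat \<times> bool) list" where
  "dart_table w = map (dart_entry w) w"

fun turn_left :: "bool \<Rightarrow> nat \<times> bool \<Rightarrow> nat \<times> bool" where
  "turn_left fwd (j, b) = (j, fwd = b)"

fun table_step :: "nat \<Rightarrow> (nat \<times> bool) list \<Rightarrow> nat \<times> bool \<Rightarrow> nat \<times> bool" where
  "table_step n tbl (i, fwd) = turn_left fwd
     (tbl ! (if fwd then (if Suc i = n then 0 else Suc i) else (case i of 0 \<Rightarrow> n - 1 | Suc j \<Rightarrow> j)))"

lemma next_dart_eq_table_step:
  assumes "valid_code w" "i < length w"
  shows "next_dart w (i, fwd) = table_step (length w) (dart_table w) (i, fwd)"
    and "fst (next_dart w (i, fwd)) < length w"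
proof -
  define k where "k = (if fwd then i + 1 else i + length w - 1) mod length w"
  have k: "k < length w"
    unfolding k_def using assms(2) by (intro mod_less_divisor) linarith
  have k_eq: "k = (if fwd then (if Suc i = length w then 0 else Suc i)
      else (case i of 0 \<Rightarrow> length w - 1 | Suc j \<Rightarrow> j))"
    using assms(2) by (auto simp: k_def split: nat.split)
  obtain c ov pos where p: "w ! k = (c, ov, pos)"
    by (cases "w ! k") auto
  note partner = partner_eq_pos_of [OF assms(1) k p]
  have step: "next_dart w (i, fwd) = (partner w k, fwd \<longleftrightarrow> (ov \<longleftrightarrow> pos))"
    by (simp add: next_dart_def k_def [symmetric] p)
  then show "fst (next_dart w (i, fwd)) < length w"
    using partner by simp
  show "next_dart w (i, fwd) = table_step (length w) (dart_table w) (i, fwd)"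
    using k by (simp add: step k_eq [symmetric] dart_table_def p partner)
qed

text \<open>\<open>n\<close> only bounds the number of steps: \<open>s\<close> occurs in the list,
  as its last entry, exactly if it is reached in time.\<close>

primrec trace :: "('a \<Rightarrow> 'a) \<Rightarrow> nat \<Rightarrow> 'a \<Rightarrow> 'a \<Rightarrow> 'a list" where
  "trace f 0 s x = []"
| "trace f (Suc n) s x = (if x = s then [s] else x # trace f n s (f x))"

lemma trace_closed:
  "s \<in> set (trace f n s x) \<Longrightarrow> y \<in> set (trace f n s x) \<Longrightarrow> y = s \<or> f y \<in> set (trace f n s x)"
proof (induction n arbitrary: x)
  case (Suc n)
  show ?case
  proof (cases "x = s")
    case False
    then have s: "s \<in> set (trace f n s (f x))"
      using Suc.prems by auto
    moreover have "f x \<in> set (trace f n s (f x))"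
      using s by (cases n) (auto split: if_splits)
    ultimately show ?thesis
      using Suc False by auto
  qed (use Suc in auto)
qed simp

lemma trace_subset_orbit: "x \<in> orbit f s \<Longrightarrow> set (trace f n s x) \<subseteq> orbit f s"
  by (induction n arbitrary: x) (auto intro: orbit.step)

text \<open>\<open>orbit f s\<close> begins with \<open>f s\<close>, hence so does the trace. Once
  the trace meets \<open>s\<close> it is closed under \<open>f\<close>: the successor of
  \<open>s\<close> is its first entry.\<close>

lemma orbit_eq_trace:
  assumes "s \<in> set (trace f n s (f s))"
  shows "orbit f s = set (trace f n s (f s))"
proof
  have first: "f s \<in> set (trace f n s (f s))"
    using assms by (cases n) (auto split: if_splits)
  have "y \<in> set (trace f n s (f s))" if "y \<in> orbit f s" for y
    using that
  proof induction
    case (step y)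
    then show ?case
      using trace_closed [OF assms] first by blast
  qed (rule first)
  then show "orbit f s \<subseteq> set (trace f n s (f s))" ..
qed (rule trace_subset_orbit [OF orbit.base])

text \<open>The darts that have not been visited yet are kept as a list of flags: entry \<open>i\<close> tells whether
  \<open>(i, True)\<close> and \<open>(i, False)\<close> are present.\<close>

definition dart_set :: "(bool \<times> bool) list \<Rightarrow> (nat \<times> bool) set" where
  "dart_set fs = {(i, b). i < length fs \<and> (if b then fst (fs ! i) else snd (fs ! i))}"

fun first_dart :: "(bool \<times> bool) list \<Rightarrow> nat \<Rightarrow> (nat \<times> bool) option" where
  "first_dart [] i = None"
| "first_dart ((x, y) # fs) i =
     (if x then Some (i, True) else if y then Some (i, False) else first_dart fs (Suc i))"

fun remove_dart :: "nat \<Rightarrow> bool \<Rightarrow> (bool \<times> bool) list \<Rightarrow> (bool \<times> bool) list" where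
  "remove_dart i b [] = []"
| "remove_dart 0 b ((x, y) # fs) = (if b then (False, y) # fs else (x, False) # fs)"
| "remove_dart (Suc i) b (f # fs) = f # remove_dart i b fs"

fun remove_darts :: "(nat \<times> bool) list \<Rightarrow> (bool \<times> bool) list \<Rightarrow> (bool \<times> bool) list" where
  "remove_darts [] fs = fs"
| "remove_darts ((i, b) # ds) fs = remove_darts ds (remove_dart i b fs)"

lemma dart_set_Nil [simp]: "dart_set [] = {}"
  by (simp add: dart_set_def)

lemma dart_set_Cons:
  "dart_set (f # fs) = (if fst f then {(0, True)} else {}) \<union> (if snd f then {(0, False)} else {}) \<union>
     (\<lambda>(i, b). (Suc i, b)) ` dart_set fs"
proof -
  have "d \<in> dart_set (f # fs) \<longleftrightarrow> d \<in> (if fst f then {(0, True)} else {}) \<union>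
      (if snd f then {(0, False)} else {}) \<union> (\<lambda>(i, b). (Suc i, b)) ` dart_set fs" for d
    by (cases d; cases "fst d") (auto simp: dart_set_def image_iff split: if_splits)
  then show ?thesis
    by blast
qed

lemma first_dart:
  "first_dart fs i = None \<Longrightarrow> dart_set fs = {}"
  "first_dart fs i = Some (j, b) \<Longrightarrow> i \<le> j \<and> (j - i, b) \<in> dart_set fs"
  by (induction fs i rule: first_dart.induct)
     (auto simp: dart_set_Cons Suc_diff_le image_iff Bex_def split: if_splits
       dest: Suc_leD intro: exI [of _ "j - Suc _"])

lemma dart_set_remove_dart: "dart_set (remove_dart i b fs) = dart_set fs - {(i, b)}"
  by (induction i b fs rule: remove_dart.induct) (auto simp: dart_set_Cons split: if_splits)

lemma dart_set_remove_darts: "dart_set (remove_darts ds fs) = dart_set fs - set ds"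
  by (induction ds fs rule: remove_darts.induct) (auto simp: dart_set_remove_dart)

text \<open>Every intermediate result is passed as an argument so that the simplifier computes it only
  once.\<close>

definition remove_orbit ::
  "(nat \<times> bool) list \<Rightarrow> nat \<times> bool \<Rightarrow> (bool \<times> bool) list \<Rightarrow> (bool \<times> bool) list option" where
  "remove_orbit ds s fs = (if ds \<noteq> [] \<and> last ds = s then Some (remove_darts ds fs) else None)"

primrec has_orbits :: "nat \<Rightarrow> (nat \<times> bool \<Rightarrow> nat \<times> bool) \<Rightarrow> nat \<Rightarrow> (bool \<times> bool) list \<Rightarrow> bool" where
  "has_orbits 0 f n fs \<longleftrightarrow> first_dart fs 0 = None"
| "has_orbits (Suc m) f n fs \<longleftrightarrow>
     (case first_dart fs 0 of None \<Rightarrow> False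
      | Some s \<Rightarrow>
          (case remove_orbit (trace f n s (f s)) s fs of None \<Rightarrow> False
           | Some fs' \<Rightarrow> has_orbits m f n fs'))"

text \<open>The second conjunct is what makes the count exact. A remaining dart lies in its own
  orbit but not in the trace just removed, so its orbit differs from that of
  \<open>s\<close>.\<close>

lemma card_orbits:
  assumes "has_orbits m f n fs"
  shows "card (orbit f ` dart_set fs) = m \<and> (\<forall>x \<in> dart_set fs. x \<in> orbit f x)"
  using assms
proof (induction m arbitrary: fs)
  case 0
  then show ?case
    using first_dart(1) by auto
next
  case (Suc m)
  then obtain s where first: "first_dart fs 0 = Some s"
    by (auto split: option.splits)
  let ?o = "set (trace f n s (f s))"
  obtain fs' where orbits: "remove_orbit (trace f n s (f s)) s fs = Some fs'" "has_orbits m f n fs'"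
    using Suc.prems first by (auto split: option.splits)
  then have "trace f n s (f s) \<noteq> []" "last (trace f n s (f s)) = s"
    by (auto simp: remove_orbit_def split: if_splits)
  then have s: "s \<in> ?o"
    using last_in_set by metis
  have fs': "dart_set fs' = dart_set fs - ?o"
    using orbits(1) by (auto simp: remove_orbit_def dart_set_remove_darts split: if_splits)
  have mem: "s \<in> dart_set fs"
    using first_dart(2) [of fs 0 "fst s" "snd s"] first by simp
  have orb: "orbit f s = ?o"
    by (rule orbit_eq_trace [OF s])
  have IH: "card (orbit f ` (dart_set fs - ?o)) = m" "\<forall>x \<in> dart_set fs - ?o. x \<in> orbit f x"
    using Suc.IH [OF orbits(2)] by (simp_all add: fs')
  have to_s: "s \<in> orbit f x" if "x \<in> ?o" for x
    using that s orbit_swap [of s f x] by (simp add: orb)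
  have same: "orbit f x = orbit f s" if "x \<in> ?o" for x
    using to_s [OF that] that orbit_trans [of _ f] unfolding orb [symmetric] by blast
  have "orbit f ` dart_set fs = insert (orbit f s) (orbit f ` (dart_set fs - ?o))"
    using same mem by blast
  moreover have "orbit f s \<notin> orbit f ` (dart_set fs - ?o)"
    using IH(2) orb by auto
  moreover have "finite (dart_set fs)"
    by (rule finite_subset [of _ "{..<length fs} \<times> UNIV"]) (auto simp: dart_set_def)
  moreover have "x \<in> orbit f x" if "x \<in> dart_set fs" for x
    using that same IH(2) s orb by (cases "x \<in> ?o") auto
  ultimately show ?case
    using IH(1) by simp
qed

text \<open>\<open>2 * length w\<close> is the number of all darts and hence a bound for the length
  of a face.\<close>

definition planar_check :: "gauss_code \<Rightarrow> bool" where
  "planar_check w \<longleftrightarrow> w = [] \<or>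
     has_orbits (length w div 2 + 2) (table_step (length w) (dart_table w)) (2 * length w)
       (replicate (length w) (True, True))"

lemma knot_diagram_if_planar_check:
  assumes valid: "valid_code w" and "planar_check w"
  shows "knot_diagram w"
proof (cases "w = []")
  case False
  let ?f = "table_step (length w) (dart_table w)"
  have f: "next_dart w d = ?f d" "fst (?f d) < length w" if "fst d < length w" for d
    using next_dart_eq_table_step [OF valid, of "fst d" "snd d"] that by simp_all
  \<comment> \<open>The two maps are known to agree only at positions inside the code. Both stay
    there, so the orbits agree.\<close>
  have "orbit (next_dart w) d = orbit ?f d" if "fst d < length w" for d
  proof -
    have "fst x < length w \<and> next_dart w x = ?f x" if "x \<in> orbit (next_dart w) d" for x
      using that f \<open>fst d < length w\<close> by induction simp_all
    moreover have "fst x < length w \<and> next_dart w x = ?f x" if "x \<in> orbit ?f d" for x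
      using that f \<open>fst d < length w\<close> by induction simp_all
    ultimately show ?thesis
      using f(1) that by (intro orbit_cong0 [of _ "{d. fst d < length w}"]) (auto simp: f)
  qed
  moreover have "dart_set (replicate (length w) (True, True)) = {..<length w} \<times> UNIV"
    by (auto simp: dart_set_def)
  ultimately have "faces w = orbit ?f ` dart_set (replicate (length w) (True, True))"
    unfolding faces_def by (auto intro!: image_cong)
  then have "card (faces w) = length w div 2 + 2"
    using assms(2) False card_orbits unfolding planar_check_def by metis
  then show ?thesis
    using valid by (simp add: knot_diagram_def planar_def)
qed (simp add: knot_diagram_def planar_def valid_code_def)

subsection \<open>Rotation\<close>

lemma partner_eqI:
  assumes "valid_code w" "k < length w" "w ! k = (c, ov, pos)" "j < length w" "w ! j = (c, \<not> ov, pos)"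
  shows "partner w k = j"
  using partner_eq_pos_of(1) [OF assms(1-3)] pos_of_nth [OF _ assms(4,5)] assms(1)
  by (simp add: valid_code_def)

lemma nth_partner:
  assumes "valid_code w" "k < length w" "w ! k = (c, ov, pos)"
  shows "w ! partner w k = (c, \<not> ov, pos)"
proof -
  have "(c, \<not> ov, pos) \<in> set w"
    using assms nth_mem [OF assms(2)] unfolding valid_code_def by auto
  then show ?thesis
    using partner_eqI [OF assms] by (auto simp: in_set_conv_nth)
qed

lemma valid_code_rotate1 [simp]: "valid_code (rotate1 w) \<longleftrightarrow> valid_code w"
  by (simp add: valid_code_def flip: rotate1_map)

lemma orbit_image:
  assumes "x \<in> A" "f \<in> A \<rightarrow> A" "\<And>y. y \<in> A \<Longrightarrow> g (h y) = h (f y)"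
  shows "orbit g (h x) = h ` orbit f x"
proof -
  have "(g ^^ n) (h x) = h ((f ^^ n) x) \<and> (f ^^ n) x \<in> A" for n
    using assms by (induction n) auto
  then show ?thesis
    by (auto simp: orbit_altdef)
qed

lemma Suc_pred_mod: "Suc ((i + m) mod Suc m) mod Suc m = i mod Suc m"
  by (metis add_Suc_right mod_Suc_eq mod_add_self2)

text \<open>\<open>rotate1\<close> moves every passage one place back cyclically, and
  \<open>i + m\<close> modulo \<open>Suc m\<close> is the predecessor of \<open>i\<close>.\<close>

lemma next_dart_rotate1:
  assumes valid: "valid_code w" and i: "i < length w" and n: "length w = Suc m"
  shows "next_dart (rotate1 w) ((i + m) mod Suc m, fwd) =
    map_prod (\<lambda>i. (i + m) mod Suc m) id (next_dart w (i, fwd))"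
proof -
  define k where "k = (if fwd then i + 1 else i + m) mod Suc m"
  define k' where "k' = (if fwd then (i + m) mod Suc m + 1 else (i + m) mod Suc m + m) mod Suc m"
  have k: "k < length w" "k' < length w" "Suc k' mod Suc m = k"
    using i Suc_pred_mod [of i m] Suc_pred_mod [of "(i + m) mod Suc m" m]
    by (auto simp: k_def k'_def n)
  have k_eq: "(if fwd then i + 1 else i + length w - 1) mod length w = k"
    "(if fwd then (i + m) mod Suc m + 1 else (i + m) mod Suc m + length w - 1) mod length w = k'"
    by (simp_all add: k_def k'_def n)
  obtain c ov pos where p: "w ! k = (c, ov, pos)"
    by (cases "w ! k") auto
  have nth: "rotate1 w ! j = w ! (Suc j mod Suc m)" if "j < Suc m" for j
    using that nth_rotate1 [of j w] by (simp add: n)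
  let ?j = "partner w k"
  have j: "?j < Suc m"
    using partner_eq_pos_of(2) [OF valid k(1) p] by (simp add: n)
  then have "Suc ((?j + m) mod Suc m) mod Suc m = ?j"
    by (simp add: Suc_pred_mod)
  then have "partner (rotate1 w) k' = (?j + m) mod Suc m"
    using k p nth nth_partner [OF valid k(1) p] valid
    by (intro partner_eqI [of _ _ c ov pos]) (simp_all add: n)
  then show ?thesis
    unfolding next_dart_def prod.case Let_def length_rotate1 k_eq p
    using k p nth by (simp add: n)
qed

text \<open>The shift of the darts conjugates the two face maps and so matches their orbits. Thanks
  to this, the rotation before each move of a certificate needs no planarity test.\<close>

lemma planar_rotate1:
  assumes "valid_code w" "planar w"
  shows "planar (rotate1 w)"
proof (cases "length w")
  case (Suc m)
  define h where "h = map_prod (\<lambda>i. (i + m) mod Suc m) (id :: bool \<Rightarrow> bool)"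
  define D where "D = {..<Suc m} \<times> (UNIV :: bool set)"
  have "(Suc ((i + m) mod Suc m)) mod Suc m = i" if "i < Suc m" for i
    using that by (simp add: Suc_pred_mod)
  then have inj: "inj_on h D"
    unfolding h_def D_def by (intro map_prod_inj_on inj_on_inverseI [of _ "\<lambda>i. Suc i mod Suc m"]) auto
  have "h ` D \<subseteq> D"
    by (auto simp: h_def D_def)
  then have surj: "h ` D = D"
    using inj by (intro card_subset_eq) (auto simp: D_def card_image)
  have closed: "next_dart w \<in> D \<rightarrow> D"
    using next_dart_eq_table_step(2) [OF assms(1)] by (auto simp: D_def Suc mem_Times_iff)
  have "orbit (next_dart (rotate1 w)) (h d) = h ` orbit (next_dart w) d" if "d \<in> D" for d
    using that next_dart_rotate1 [OF assms(1) _ Suc]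
    by (intro orbit_image [OF _ closed]) (auto simp: h_def D_def Suc)
  then have "orbit (next_dart (rotate1 w)) ` (h ` D) = (`) h ` (orbit (next_dart w) ` D)"
    by (auto simp: image_image intro!: image_cong)
  then have "faces (rotate1 w) = (`) h ` faces w"
    by (simp only: surj) (simp add: faces_def D_def Suc)
  moreover have "\<Union> (faces w) \<subseteq> D"
  proof -
    have "x \<in> D" if "d \<in> D" "x \<in> orbit (next_dart w) d" for x d
      using that(2,1) closed by induction auto
    then show ?thesis
      by (auto simp: faces_def D_def Suc)
  qed
  ultimately have "card (faces (rotate1 w)) = card (faces w)"
    using inj_on_subset [OF inj_on_image_Pow [OF inj], of "faces w"] by (auto intro!: card_image)
  then show ?thesis
    using assms(2) by (cases w) (simp_all add: planar_def)
qed (simp add: planar_def)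

lemma rotate_isotopic:
  assumes "knot_diagram w"
  shows "knot_diagram (rotate n w) \<and> isotopic w (rotate n w)"
proof (induction n)
  case (Suc n)
  then have "knot_diagram (rotate (Suc n) w)"
    using planar_rotate1 by (simp add: knot_diagram_def)
  moreover from this have "isotopic (rotate n w) (rotate (Suc n) w)"
    using Suc isotopic_move code_move.rotate by simp
  ultimately show ?case
    using Suc isotopic_trans by blast
qed (use assms in simp)


subsection \<open>Running a list of moves\<close>

text \<open>Every move is performed at the base point, after a rotation. \<open>Add_Bigon\<close> is the inverse of
  \<open>Bigon\<close>.\<close>

datatype move =
    Mirror
  | Reverse
  | Rename "nat list"
  | Kink
  | Bigon nat
  | Add_Bigon nat nat bool bool bool nat
  | Triangle nat nat

definition bigon_return :: "nat \<Rightarrow> nat \<Rightarrow> bool \<Rightarrow> bool \<Rightarrow> bool \<Rightarrow> passage \<times> passage" where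
  "bigon_return c d ov pos par =
     (if par then ((c, \<not> ov, pos), (d, \<not> ov, \<not> pos)) else ((d, \<not> ov, \<not> pos), (c, \<not> ov, pos)))"

definition bigon :: "passage \<Rightarrow> passage \<Rightarrow> passage \<Rightarrow> passage \<Rightarrow> bool" where
  "bigon p q r s \<longleftrightarrow> (case p of (c, ov, pos) \<Rightarrow>
     q = (fst q, ov, \<not> pos) \<and> (r, s) = bigon_return c (fst q) ov pos (fst r = c))"

definition meets :: "passage \<Rightarrow> passage \<Rightarrow> bool" where
  "meets x y \<longleftrightarrow> (case x of (c, ov, pos) \<Rightarrow> ov \<and> y = (c, False, pos))"

definition orient :: "bool \<Rightarrow> 'a \<times> 'a \<Rightarrow> 'a \<times> 'a" where
  "orient d x = (if d then x else prod.swap x)"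

text \<open>\<open>X\<close>, \<open>Y\<close>, \<open>Z\<close> are the edges on the top, middle and bottom strand, and \<open>p\<close>, \<open>q\<close>, \<open>r\<close> are as in rule
  \<open>R3\<close>.\<close>

definition triangle_at ::
  "bool \<Rightarrow> bool \<Rightarrow> bool \<Rightarrow> passage \<times> passage \<Rightarrow> passage \<times> passage \<Rightarrow> passage \<times> passage \<Rightarrow> bool" where
  "triangle_at p q r X Y Z \<longleftrightarrow>
     (case (orient p X, orient q Y, orient r Z) of
        ((ta, tb), (ma, mc), (bb, bc)) \<Rightarrow>
          meets ta ma \<and> meets tb bb \<and> meets mc bc \<and>
          (snd (snd ta) \<longleftrightarrow> (p \<longleftrightarrow> q)) = (snd (snd tb) \<longleftrightarrow> (p \<longleftrightarrow> r)) \<and>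
          (snd (snd ta) \<longleftrightarrow> (p \<longleftrightarrow> q)) = (snd (snd mc) \<longleftrightarrow> (q \<longleftrightarrow> r)))"

text \<open>The directions are read off the code. The top strand meets \<open>a\<close> first iff
  its first crossing lies on the middle strand; the middle strand meets \<open>a\<close> first iff
  it starts below; the bottom strand meets \<open>b\<close> first iff its first crossing is not on
  the middle strand.\<close>

definition triangle :: "passage \<times> passage \<Rightarrow> passage \<times> passage \<Rightarrow> passage \<times> passage \<Rightarrow> bool" where
  "triangle X Y Z \<longleftrightarrow>
     triangle_at (fst (fst X) = fst (fst Y) \<or> fst (fst X) = fst (snd Y)) (\<not> fst (snd (fst Y)))
       (fst (fst Z) \<noteq> fst (fst Y) \<and> fst (fst Z) \<noteq> fst (snd Y)) X Y Z"

definition triangle_any :: "passage \<times> passage \<Rightarrow> passage \<times> passage \<Rightarrow> passage \<times> passage \<Rightarrow> bool" where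
  "triangle_any X Y Z \<longleftrightarrow> triangle X Y Z \<or> triangle X Z Y \<or> triangle Y X Z \<or> triangle Y Z X \<or>
     triangle Z X Y \<or> triangle Z Y X"

fun apply_move :: "move \<Rightarrow> gauss_code \<Rightarrow> gauss_code option" where
  "apply_move Mirror w = Some (mirror w)"
| "apply_move Reverse w = Some (rev w)"
| "apply_move (Rename ls) w =
     (if distinct (map ((!) ls) (remdups (map fst w)))
      then Some (map (\<lambda>(c, ov, pos). (ls ! c, ov, pos)) w) else None)"
| "apply_move Kink w =
     (case w of (c, ov, pos) # q # v \<Rightarrow> if q = (c, \<not> ov, pos) then Some v else None | _ \<Rightarrow> None)"
| "apply_move (Bigon n) w =
     (case w of p # q # v \<Rightarrow>
        (case drop n v of r # s # v' \<Rightarrow> if bigon p q r s then Some (take n v @ v') else None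
         | _ \<Rightarrow> None)
      | _ \<Rightarrow> None)"
| "apply_move (Add_Bigon c d ov pos par n) w =
     (case bigon_return c d ov pos par of (r, s) \<Rightarrow>
        if c = d \<or> c \<in> fst ` set w \<or> d \<in> fst ` set w then None
        else Some ((c, ov, pos) # (d, ov, \<not> pos) # take n w @ r # s # drop n w))"
| "apply_move (Triangle m n) w =
     (case w of x # x' # v \<Rightarrow>
        (case drop m v of y # y' # v' \<Rightarrow>
           (case drop n v' of z # z' # v'' \<Rightarrow>
              if triangle_any (x, x') (y, y') (z, z')
              then Some (x' # x # take m v @ y' # y # take n v' @ z' # z # v'') else None
            | _ \<Rightarrow> None)
         | _ \<Rightarrow> None)
      | _ \<Rightarrow> None)"

text \<open>The last diagram is not checked, as it belongs to the table.\<close>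

fun leads_to :: "gauss_code \<Rightarrow> (nat \<times> move) list \<Rightarrow> gauss_code \<Rightarrow> bool" where
  "leads_to w [] w' \<longleftrightarrow> w = w'"
| "leads_to w ((n, m) # ms) w' \<longleftrightarrow>
     (case apply_move m (rotate n w) of None \<Rightarrow> False
      | Some v \<Rightarrow> (if ms = [] then v = w' else planar_check v \<and> leads_to v ms w'))"

lemma code_move_bigon:
  assumes "(r, s) = bigon_return c d ov pos par"
  shows "code_move ((c, ov, pos) # (d, ov, \<not> pos) # v @ r # s # w) (v @ w)"
  using assms code_move.R2_parallel [of "[]" c ov pos d v w]
    code_move.R2_antiparallel [of "[]" c ov pos d v w]
  by (auto simp: bigon_return_def split: if_splits)

lemma code_move_triangle:
  assumes "triangle_any (x, x') (y, y') (z, z')"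
  shows "code_move (x # x' # v @ y # y' # w @ z # z' # u) (x' # x # v @ y' # y # w @ z' # z # u)"
proof -
  have *: ?thesis
    if "triangle (t, t') (m, m') (b, b')"
      and eq: "{[x, x'], [y, y'], [z, z']} = {[t, t'], [m, m'], [b, b']}" for t t' m m' b b'
  proof -
    obtain p q r where tri: "triangle_at p q r (t, t') (m, m') (b, b')"
      using \<open>triangle (t, t') (m, m') (b, b')\<close> unfolding triangle_def by blast
    obtain ta tb ma mc bb bc where
      dirs: "orient p (t, t') = (ta, tb)" "orient q (m, m') = (ma, mc)" "orient r (b, b') = (bb, bc)"
      by (metis surj_pair)
    then have meets: "meets ta ma" "meets tb bb" "meets mc bc"
      and signs: "(snd (snd ta) \<longleftrightarrow> (p \<longleftrightarrow> q)) = (snd (snd tb) \<longleftrightarrow> (p \<longleftrightarrow> r))"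
        "(snd (snd ta) \<longleftrightarrow> (p \<longleftrightarrow> q)) = (snd (snd mc) \<longleftrightarrow> (q \<longleftrightarrow> r))"
      using tri by (auto simp: triangle_at_def)
    obtain ca sa cb sb cc sc where
      pas: "ta = (ca, True, sa)" "ma = (ca, False, sa)" "tb = (cb, True, sb)" "bb = (cb, False, sb)"
        "mc = (cc, True, sc)" "bc = (cc, False, sc)"
      using meets by (auto simp: meets_def split: prod.splits)
    have segs: "[t, t'] = seg p (ca, True, sa) (cb, True, sb)"
        "[m, m'] = seg q (ca, False, sa) (cc, True, sc)"
        "[b, b'] = seg r (cb, False, sb) (cc, False, sc)"
      using dirs by (simp_all add: pas orient_def seg_def split: if_splits)
    have "code_move ([] @ [x, x'] @ v @ [y, y'] @ w @ [z, z'] @ u)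
        ([] @ rev [x, x'] @ v @ rev [y, y'] @ w @ rev [z, z'] @ u)"
      \<comment> \<open>The orientation of the triangle is not recorded anywhere. The sign at the
        top-middle crossing determines it, and the two equations in \<open>triangle_at\<close> say
        that the other crossings give the same value.\<close>
      by (rule code_move.R3 [where e = "sa \<longleftrightarrow> (p \<longleftrightarrow> q)", OF _ _ _ eq [unfolded segs]])
         (use signs in \<open>auto simp: pas\<close>)
    then show ?thesis
      by simp
  qed
  show ?thesis
    using assms unfolding triangle_any_def by (elim disjE) (erule *, simp add: insert_commute)+
qed

lemma apply_move_cases:
  assumes "apply_move m w = Some w'"
  shows "w' = mirror w \<or> code_move w w' \<or> code_move w' w"
proof (cases m)
  case (Rename ls)
  then have "distinct (map ((!) ls) (remdups (map fst w)))"
    and w': "w' = map (\<lambda>(c, ov, pos). (ls ! c, ov, pos)) w"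
    using assms by (auto split: if_splits)
  then have "inj_on ((!) ls) (fst ` set w)"
    by (simp add: distinct_map)
  then show ?thesis
    unfolding w' using code_move.relabel by blast
next
  case Kink
  then obtain c ov pos where "w = (c, ov, pos) # (c, \<not> ov, pos) # w'"
    using assms by (auto split: list.splits if_splits)
  then show ?thesis
    using code_move.R1 [of "[]" c ov pos w'] by simp
next
  case (Bigon n)
  then obtain p q v r s v' where w: "w = p # q # v" "drop n v = r # s # v'" "bigon p q r s"
    "w' = take n v @ v'"
    using assms by (auto split: list.splits if_splits)
  obtain c ov pos where p: "p = (c, ov, pos)"
    by (cases p) auto
  have v: "v = take n v @ r # s # v'"
    using w(2) by (metis append_take_drop_id)
  have "q = (fst q, ov, \<not> pos)" "(r, s) = bigon_return c (fst q) ov pos (fst r = c)"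
    using w(3) by (auto simp: bigon_def p)
  then show ?thesis
    using code_move_bigon w v p by metis
next
  case (Add_Bigon c d ov pos par n)
  obtain r s where rs: "(r, s) = bigon_return c d ov pos par"
    by (metis surj_pair)
  then have "w' = (c, ov, pos) # (d, ov, \<not> pos) # take n w @ r # s # drop n w"
    using assms Add_Bigon by (simp split: if_splits flip: rs)
  then show ?thesis
    using code_move_bigon [OF rs, of "take n w" "drop n w"] by simp
next
  case (Triangle k n)
  then obtain x x' v y y' v' z z' v'' where w: "w = x # x' # v" "drop k v = y # y' # v'"
    "drop n v' = z # z' # v''" "triangle_any (x, x') (y, y') (z, z')"
    "w' = x' # x # take k v @ y' # y # take n v' @ z' # z # v''"
    using assms by (auto split: list.splits if_splits)
  have "v = take k v @ y # y' # v'" "v' = take n v' @ z # z' # v''"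
    using w(2,3) by (metis append_take_drop_id)+
  then show ?thesis
    using code_move_triangle [OF w(4), of "take k v" "take n v'" v''] w(1,5) by metis
qed (use assms code_move.reverse in auto)

section \<open>Validity of codes along a list of moves\<close>

lemma valid_codeD: "valid_code w \<Longrightarrow> (c, ov, pos) \<in> set w \<Longrightarrow> (c, \<not> ov, pos) \<in> set w"
  unfolding valid_code_def by fast

lemma valid_codeI:
  assumes "distinct (map (\<lambda>(c, ov, pos). (c, ov)) w)"
    and "\<And>c ov pos. (c, ov, pos) \<in> set w \<Longrightarrow> (c, \<not> ov, pos) \<in> set w"
  shows "valid_code w"
  using assms unfolding valid_code_def by fast

lemma valid_code_mset_eq:
  assumes "valid_code w" "mset w = mset w'"
  shows "valid_code w'"
  using assms(1) distinct_keys [OF assms] mset_eq_setD [OF assms(2)] by (simp add: valid_code_def)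

lemma valid_code_remove:
  assumes valid: "valid_code w" and mset: "mset w = mset (x @ y)"
    and closed: "\<And>c ov pos. (c, ov, pos) \<in> set x \<Longrightarrow> (c, \<not> ov, pos) \<in> set x"
  shows "valid_code y"
proof -
  have xy: "valid_code (x @ y)"
    by (rule valid_code_mset_eq [OF valid mset])
  then have dist: "distinct (map (\<lambda>(c, ov, pos). (c, ov)) (x @ y))"
    by (simp add: valid_code_def)
  have partner: "(c, \<not> ov, pos) \<in> set x \<union> set y" if "(c, ov, pos) \<in> set y" for c ov pos
    using valid_codeD [OF xy] that by simp
  have "distinct (x @ y)"
    using dist by (simp only: distinct_map)
  then have "set x \<inter> set y = {}"
    by simp
  then have "(c, \<not> ov, pos) \<in> set y" if "(c, ov, pos) \<in> set y" for c ov pos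
    using partner [OF that] closed [of c "\<not> ov" pos] that by auto
  then show ?thesis
    using dist by (intro valid_codeI) simp_all
qed

lemma valid_code_add:
  assumes valid: "valid_code w" and mset: "mset w' = mset (x @ w)"
    and x: "valid_code x" and disj: "fst ` set x \<inter> fst ` set w = {}"
  shows "valid_code w'"
proof -
  have "(\<lambda>(c, ov, pos). (c, ov)) ` set x \<inter> (\<lambda>(c, ov, pos). (c, ov)) ` set w = {}"
    using disj by force
  then have "valid_code (x @ w)"
    using valid x by (auto simp: valid_code_def)
  then show ?thesis
    by (rule valid_code_mset_eq) (simp add: mset)
qed

lemma valid_code_relabel:
  assumes valid: "valid_code w" and inj: "inj_on f (fst ` set w)"
  shows "valid_code (map (\<lambda>(c, ov, pos). (f c, ov, pos)) w)"
proof -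
  let ?key = "\<lambda>(c, ov, pos). (c, ov) :: nat \<times> bool"
  have "inj_on (map_prod f id) (fst ` set w \<times> (UNIV :: bool set))"
    by (intro map_prod_inj_on inj) simp
  moreover have "?key ` set w \<subseteq> fst ` set w \<times> UNIV"
    by force
  ultimately have "inj_on (map_prod f id) (set (map ?key w))"
    using inj_on_subset by (metis list.set_map)
  moreover have "distinct (map ?key w)"
    using valid by (simp add: valid_code_def)
  ultimately have "distinct (map (map_prod f id) (map ?key w))"
    by (simp only: distinct_map [of "map_prod f id"])
  moreover have "map (map_prod f id) (map ?key w) = map ?key (map (\<lambda>(c, ov, pos). (f c, ov, pos)) w)"
    by (simp add: case_prod_unfold map_prod_def)
  ultimately have dist: "distinct (map ?key (map (\<lambda>(c, ov, pos). (f c, ov, pos)) w))"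
    by (rule back_subst [of distinct])
  show ?thesis
  proof (rule valid_codeI [OF dist])
    fix c ov pos
    assume "(c, ov, pos) \<in> set (map (\<lambda>(c, ov, pos). (f c, ov, pos)) w)"
    then obtain a where a: "(a, ov, pos) \<in> set w" "c = f a"
      by auto
    have "(a, \<not> ov, pos) \<in> set w"
      by (rule valid_codeD [OF valid a(1)])
    then show "(c, \<not> ov, pos) \<in> set (map (\<lambda>(c, ov, pos). (f c, ov, pos)) w)"
      by (force simp: a(2))
  qed
qed

text \<open>Validity is therefore evaluated for the initial diagram only, while planarity has to be
  evaluated again along the way.\<close>

lemma valid_code_apply_move:
  assumes "apply_move m w = Some w'" and valid: "valid_code w"
  shows "valid_code w'"
proof (cases m)
  case Mirror
  then show ?thesis
    using assms by auto
next
  case Reverse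
  then show ?thesis
    using assms by (auto intro: valid_code_mset_eq [OF valid])
next
  case (Rename ls)
  then have "distinct (map ((!) ls) (remdups (map fst w)))"
    and w': "w' = map (\<lambda>(c, ov, pos). (ls ! c, ov, pos)) w"
    using assms by (auto split: if_splits)
  then have "inj_on ((!) ls) (fst ` set w)"
    by (simp add: distinct_map)
  then show ?thesis
    unfolding w' by (rule valid_code_relabel [OF valid])
next
  case Kink
  then obtain c ov pos where "w = [(c, ov, pos), (c, \<not> ov, pos)] @ w'"
    using assms by (auto split: list.splits if_splits)
  then show ?thesis
    using valid_code_remove [OF valid, of "[(c, ov, pos), (c, \<not> ov, pos)]" w'] by auto
next
  case (Bigon n)
  then obtain p q v r s v' where w: "w = p # q # v" "drop n v = r # s # v'" "bigon p q r s"
    "w' = take n v @ v'"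
    using assms by (auto split: list.splits if_splits)
  obtain c ov pos where p: "p = (c, ov, pos)"
    by (cases p) auto
  have v: "v = take n v @ r # s # v'"
    using w(2) by (metis append_take_drop_id)
  have "q = (fst q, ov, \<not> pos)" "(r, s) = bigon_return c (fst q) ov pos (fst r = c)"
    using w(3) by (auto simp: bigon_def p)
  then obtain d where q: "q = (d, ov, \<not> pos)" and rs: "(r, s) = bigon_return c d ov pos (fst r = c)"
    by (metis fst_conv)
  have "mset w = mset ([p, q, r, s] @ w')"
    unfolding w(1,4) by (subst v) simp
  moreover have "(c', \<not> ov', pos') \<in> set [p, q, r, s]" if "(c', ov', pos') \<in> set [p, q, r, s]" for c' ov' pos'
    using that rs by (auto simp: p q bigon_return_def split: if_splits)
  ultimately show ?thesis
    by (rule valid_code_remove [OF valid])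
next
  case (Add_Bigon c d ov pos par n)
  obtain r s where rs: "(r, s) = bigon_return c d ov pos par"
    by (metis surj_pair)
  then have w': "w' = (c, ov, pos) # (d, ov, \<not> pos) # take n w @ r # s # drop n w"
    and fresh: "c \<noteq> d" "c \<notin> fst ` set w" "d \<notin> fst ` set w"
    using assms Add_Bigon by (simp_all split: if_splits flip: rs)
  let ?x = "[(c, ov, pos), (d, ov, \<not> pos), r, s]"
  have "mset w = mset (take n w @ drop n w)"
    by simp
  then have "mset w' = mset (?x @ w)"
    unfolding w' by (simp only: mset_append mset.simps) simp
  moreover have "valid_code ?x" "fst ` set ?x \<inter> fst ` set w = {}"
    using fresh rs by (auto simp: valid_code_def bigon_return_def split: if_splits)
  ultimately show ?thesis
    by (rule valid_code_add [OF valid])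
next
  case (Triangle k n)
  then obtain x x' v y y' v' z z' v'' where w: "w = x # x' # v" "drop k v = y # y' # v'"
    "drop n v' = z # z' # v''" "w' = x' # x # take k v @ y' # y # take n v' @ z' # z # v''"
    using assms by (auto split: list.splits if_splits)
  have "v = take k v @ y # y' # take n v' @ z # z' # v''"
    using w(2,3) by (metis append_take_drop_id)
  then have "mset v = mset (take k v @ y # y' # take n v' @ z # z' # v'')"
    by (rule arg_cong)
  then have "mset w = mset w'"
    unfolding w(1,4) by simp
  then show ?thesis
    by (rule valid_code_mset_eq [OF valid])
qed

text \<open>\<open>Mirror\<close> is not an isotopy, so it is the type up to mirror image that is
  carried along.\<close>

lemma knot_type_eq_if_leads_to:
  assumes "leads_to w ms w'" "knot_diagram w" "knot_diagram w'"
  shows "knot_type w = knot_type w'"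
  using assms
proof (induction w ms w' rule: leads_to.induct)
  case (2 w n m ms w')
  obtain v where v1: "apply_move m (rotate n w) = Some v"
    using "2.prems"(1) by (cases "apply_move m (rotate n w)") auto
  have "if ms = [] then v = w' else planar_check v \<and> leads_to v ms w'"
    using "2.prems"(1) by (simp only: leads_to.simps v1 option.case)
  note v = v1 this
  have rot: "knot_diagram (rotate n w)" "isotopic w (rotate n w)"
    using rotate_isotopic [OF "2.prems"(2)] by auto
  have "valid_code v"
    using valid_code_apply_move [OF v(1)] rot(1) by (simp add: knot_diagram_def)
  then have diagram: "knot_diagram v"
    using v(2) "2.prems"(3) knot_diagram_if_planar_check [of v] by (cases "ms = []") simp_all
  have "knot_type w = knot_type (rotate n w)"
    by (rule knot_type_eq_if_isotopic [OF rot(2)])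
  also have "\<dots> = knot_type v"
    using apply_move_cases [OF v(1)] isotopic_move rot(1) diagram
    by (metis knot_type_eq_if_isotopic knot_type_mirror)
  also have "\<dots> = knot_type w'"
  proof (cases "ms = []")
    case False
    then show ?thesis
      using "2.IH" [OF v(1) False _ diagram "2.prems"(3)] v(2) by simp
  qed (use v(2) in simp)
  finally show ?case .
qed simp

section \<open>Certificates for the tie knots\<close>

definition reduces :: "gauss_code \<Rightarrow> (nat \<times> move) list \<Rightarrow> gauss_code \<Rightarrow> bool" where
  "reduces w ms w' \<longleftrightarrow> valid_code w \<and> planar_check w \<and> leads_to w ms w'"

type_synonym certificate = "(nat \<times> nat) \<times> (region list \<times> (nat \<times> move) list) list"

text \<open>Recursive functions instead of bounded quantifiers keep the simplifier from evaluating the body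
  of the quantifier symbolically.\<close>

fun all_reduce :: "gauss_code \<Rightarrow> (region list \<times> (nat \<times> move) list) list \<Rightarrow> bool" where
  "all_reduce w' [] \<longleftrightarrow> True"
| "all_reduce w' ((w, ms) # rs) \<longleftrightarrow>
     reduces (tie_diagram (with_directions w)) ms w' \<and> all_reduce w' rs"

fun certified :: "((nat \<times> nat) \<times> gauss_code) list \<Rightarrow> certificate list \<Rightarrow> bool" where
  "certified tbl [] \<longleftrightarrow> True"
| "certified tbl ((k, rs) # cs) \<longleftrightarrow> all_reduce (the (map_of tbl k)) rs \<and> certified tbl cs"

lemma all_reduceD:
  "all_reduce w' rs \<Longrightarrow> (w, ms) \<in> set rs \<Longrightarrow> reduces (tie_diagram (with_directions w)) ms w'"
  by (induction w' rs rule: all_reduce.induct) auto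

lemma certifiedD: "certified tbl cs \<Longrightarrow> (k, rs) \<in> set cs \<Longrightarrow> all_reduce (the (map_of tbl k)) rs"
  by (induction tbl cs rule: certified.induct) auto

lemma rolfsen_table_diagrams:
  assumes "k \<in> fst ` set rolfsen_table"
  shows "knot_diagram (the (map_of rolfsen_table k))"
proof -
  have checks: "\<forall>(k, w) \<in> set rolfsen_table. valid_code w \<and> planar_check w"
    by code_simp
  obtain w where w: "map_of rolfsen_table k = Some w"
    using assms by (metis domD dom_map_of_conv_image_fst)
  then show ?thesis
    using checks map_of_SomeD [OF w] knot_diagram_if_planar_check by force
qed

lemma tie_knot_if_certified:
  assumes "certified rolfsen_table cs" "((n, k), rs) \<in> set cs" "w \<in> fst ` set rs"
    and "(n, k) \<in> fst ` set rolfsen_table"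
  shows "tie_knot (with_directions w) = rolfsen n k"
proof -
  obtain ms where "reduces (tie_diagram (with_directions w)) ms (the (map_of rolfsen_table (n, k)))"
    using all_reduceD [OF certifiedD [OF assms(1,2)]] assms(3) by fastforce
  then show ?thesis
    using knot_type_eq_if_leads_to knot_diagram_if_planar_check rolfsen_table_diagrams [OF assms(4)]
    unfolding tie_knot_def rolfsen_def reduces_def by blast
qed

section \<open>The knots of the table are distinct\<close>

subsection \<open>Computing with colourings modulo an integer\<close>

fun alternating :: "gauss_code \<Rightarrow> bool" where
  "alternating [] \<longleftrightarrow> True"
| "alternating ((_, ov, _) # (_, ov', _) # w) \<longleftrightarrow> ov \<and> \<not> ov' \<and> alternating w"
| "alternating [_] \<longleftrightarrow> False"

text \<open>In an alternating code every arc passes over exactly one crossing, so the arcs correspond to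
  the crossings. A triple \<open>(i, k, j)\<close> says that \<open>i\<close> and \<open>j\<close> are separated by \<open>k\<close>.\<close>

fun relations :: "nat \<Rightarrow> gauss_code \<Rightarrow> (nat \<times> nat \<times> nat) list" where
  "relations e ((c, _, _) # (k, _, pos) # w) =
     (if pos then (c, k, case w of [] \<Rightarrow> e | p # _ \<Rightarrow> fst p)
      else (case w of [] \<Rightarrow> e | p # _ \<Rightarrow> fst p, k, c)) # relations e w"
| "relations e _ = []"

definition satisfies :: "'a::comm_ring_1 \<Rightarrow> (nat \<Rightarrow> 'a) \<Rightarrow> nat \<times> nat \<times> nat \<Rightarrow> bool" where
  "satisfies t g r \<longleftrightarrow> (case r of (i, k, j) \<Rightarrow> g j = t * g i + (1 - t) * g k)"

text \<open>A negative crossing acts by \<open>u\<close>. Solved for the incoming colour, this is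
  the relation of a positive crossing with the two lower arcs exchanged, so \<open>relations\<close>
  can be stated with \<open>t\<close> alone.\<close>

lemma act_eq_iff:
  assumes "t * u = 1"
  shows "act t u pos x z = y \<longleftrightarrow>
    (if pos then y = t * x + (1 - t) * z else x = t * y + (1 - t) * z)"
  using act_cancel [OF assms, of pos] act_cancel [OF assms, of "\<not> pos"]
  by (auto simp: act_def)

text \<open>Every over-passage identifies the colour of the strand with that of its crossing, which
  leaves one relation per under-passage. \<open>e\<close> names the arc after the last one; in a
  closed code this is the first arc.\<close>

lemma travel_alternating:
  assumes "t * u = 1" "alternating w" "w \<noteq> []"
  shows "travel t u g w x (g e) \<longleftrightarrow>
    x = g (fst (hd w)) \<and> (\<forall>r \<in> set (relations e w). satisfies t g r)"
  using assms(2,3)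
proof (induction w arbitrary: x rule: alternating.induct)
  case (2 c ov pos k ov' pos' w)
  show ?case
  proof (cases w)
    case Nil
    then show ?thesis
      using 2 act_eq_iff [OF assms(1)] by (auto simp: satisfies_def)
  next
    case (Cons p v)
    then show ?thesis
      using 2 act_eq_iff [OF assms(1), of pos' _ "g k" "g (fst p)"] by (auto simp: satisfies_def)
  qed
qed auto

text \<open>Each case solves \<open>g j = t * g i + (1 - t) * g k\<close> for its unknown, where
  \<open>u\<close> and \<open>s\<close> are the inverses of \<open>t\<close> and
  \<open>1 - t\<close>. If all three colours are known, the relation is left as a condition for
  \<open>residual\<close>.\<close>

fun deduce ::
  "int \<Rightarrow> int \<Rightarrow> int \<Rightarrow> int \<Rightarrow> nat \<times> nat \<times> nat \<Rightarrow> int option \<Rightarrow> int option \<Rightarrow> int option \<Rightarrow> (nat \<times> int) list"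
where
  "deduce n t u s (i, k, j) (Some x) (Some z) None = [(j, (t * x + (1 - t) * z) mod n)]"
| "deduce n t u s (i, k, j) None (Some z) (Some y) = [(i, (u * y + (1 - u) * z) mod n)]"
| "deduce n t u s (i, k, j) (Some x) None (Some y) = [(k, s * (y - t * x) mod n)]"
| "deduce n t u s _ _ _ _ = []"

fun learn ::
  "int \<Rightarrow> int \<Rightarrow> int \<Rightarrow> int \<Rightarrow> nat \<times> nat \<times> nat \<Rightarrow> (nat \<times> int) list \<Rightarrow> (nat \<times> int) list" where
  "learn n t u s (i, k, j) A = deduce n t u s (i, k, j) (map_of A i) (map_of A k) (map_of A j) @ A"

fun residual :: "int \<Rightarrow> (nat \<times> int) list \<Rightarrow> nat \<times> nat \<times> nat \<Rightarrow> int" where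
  "residual t A (i, k, j) =
     the (map_of A j) - t * the (map_of A i) - (1 - t) * the (map_of A k)"

text \<open>Three rounds of deduction suffice for all diagrams below.\<close>

definition solution :: "int \<Rightarrow> int \<Rightarrow> int \<Rightarrow> int \<Rightarrow> nat \<Rightarrow> nat \<Rightarrow> gauss_code \<Rightarrow> (nat \<times> int) list" where
  "solution n t u s a b w =
     (let rels = relations (fst (hd w)) w in fold (learn n t u s) (rels @ rels @ rels) [(a, 0), (b, 1)])"

definition divisor :: "int \<Rightarrow> int \<Rightarrow> (nat \<times> nat \<times> nat) list \<Rightarrow> nat set \<Rightarrow> (nat \<times> int) list \<Rightarrow> int option" where
  "divisor n t rels cs A =
     (if cs \<subseteq> fst ` set A then Some (fold gcd (map (residual t A) rels) n) else None)"

definition torsion :: "int \<Rightarrow> int \<Rightarrow> int \<Rightarrow> int \<Rightarrow> nat \<Rightarrow> nat \<Rightarrow> gauss_code \<Rightarrow> int \<Rightarrow> bool" where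
  "torsion n t u s a b w d \<longleftrightarrow>
     w \<noteq> [] \<and> alternating w \<and> a \<noteq> b \<and> a \<in> fst ` set w \<and> b \<in> fst ` set w \<and>
     divisor n t (relations (fst (hd w)) w) (fst ` set w) (solution n t u s a b w) = Some d"

section \<open>Soundness of the elimination\<close>

lemma map_of_learn: "map_of A c = Some x \<Longrightarrow> map_of (learn n t u s r A) c = Some x"
  by (cases r; cases "map_of A (fst r)"; cases "map_of A (fst (snd r))"; cases "map_of A (snd (snd r))")
     auto

lemma map_of_fold_learn: "map_of A c = Some x \<Longrightarrow> map_of (fold (learn n t u s) rels A) c = Some x"
  by (induction rels arbitrary: A) (auto intro: map_of_learn)

lemma fold_gcd_dvd:
  fixes m :: int
  shows "fold gcd xs m dvd m \<and> (\<forall>x \<in> set xs. fold gcd xs m dvd x)"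
  by (induction xs arbitrary: m) (auto intro: dvd_trans)

lemma of_int_gcd_mult_eq_0:
  fixes y :: "'a::comm_ring_1"
  assumes "of_int a * y = 0" "of_int b * y = 0"
  shows "of_int (gcd a b) * y = 0"
proof -
  obtain p q where "p * a + q * b = gcd a b"
    using bezout_int by blast
  then have "of_int (gcd a b) * y = of_int p * (of_int a * y) + of_int q * (of_int b * y)"
    by (metis (no_types, lifting) distrib_right mult.assoc of_int_add of_int_mult)
  then show ?thesis
    using assms by simp
qed

lemma of_int_fold_gcd_mult_eq_0:
  fixes y :: "'a::comm_ring_1"
  assumes "of_int m * y = 0" "\<And>x. x \<in> set xs \<Longrightarrow> of_int x * y = 0"
  shows "of_int (fold gcd xs m) * y = 0"
  using assms by (induction xs arbitrary: m) (auto intro: of_int_gcd_mult_eq_0)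

text \<open>All evaluation takes place in \<open>int\<close>. Assumption \<open>zero\<close> makes
  the image of the integers in the ring a copy of the integers modulo \<open>n\<close>, so that
  congruences become equations there.\<close>

locale residues_modulo =
  fixes n t u s :: int and ring :: "'a::comm_ring_1 itself"
  assumes zero: "(of_int k :: 'a) = 0 \<longleftrightarrow> n dvd k"
    and pos: "n > 0" and unit: "n dvd t * u - 1" "n dvd s * (1 - t) - 1"
begin

definition "T = (of_int t :: 'a)"
definition "U = (of_int u :: 'a)"
definition "S = (of_int s :: 'a)"

lemma units: "T * U = 1" "S * (1 - T) = 1"
  using unit zero [of "t * u - 1"] zero [of "s * (1 - t) - 1"] by (simp_all add: T_def U_def S_def)

lemma of_int_mod: "(of_int (x mod n) :: 'a) = of_int x"
proof -
  have "(of_int (x - x mod n) :: 'a) = 0"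
    unfolding zero by (simp add: dvd_minus_mod)
  then show ?thesis
    by simp
qed

text \<open>\<open>p\<close> is the colour of the first seed and \<open>y\<close> the difference to
  the second; the table holds the coefficients of \<open>y\<close>. As \<open>t\<close> and
  \<open>1 - t\<close> add up to 1, the offset \<open>p\<close> survives every deduction.\<close>

lemma learn_sound:
  assumes "satisfies T g r" and A: "\<forall>(c, x) \<in> set A. g c = p + of_int x * y"
  shows "\<forall>(c, x) \<in> set (learn n t u s r A). g c = p + of_int x * y"
proof -
  obtain i k j where r: "r = (i, k, j)"
    by (cases r) auto
  have sat: "g j = T * g i + (1 - T) * g k"
    using assms(1) by (simp add: satisfies_def r)
  have g: "g c = p + of_int x * y" if "map_of A c = Some x" for c x
    using A map_of_SomeD [OF that] by auto
  have 1: "g j = p + of_int ((t * x + (1 - t) * z) mod n) * y"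
    if "map_of A i = Some x" "map_of A k = Some z" for x z
    using g [OF that(1)] g [OF that(2)] sat
    by (simp add: of_int_mod T_def algebra_simps)
  have 2: "g i = p + of_int ((u * x + (1 - u) * z) mod n) * y"
    if "map_of A j = Some x" "map_of A k = Some z" for x z
  proof -
    have "g i = U * g j + (1 - U) * g k"
      using sat act_cancel [OF units(1), of False "g i" "g k"] by (simp add: act_def)
    then show ?thesis
      using g [OF that(1)] g [OF that(2)] by (simp add: of_int_mod U_def algebra_simps)
  qed
  have 3: "g k = p + of_int (s * (x - t * z) mod n) * y"
    if "map_of A j = Some x" "map_of A i = Some z" for x z
  proof -
    have "g k = (S * (1 - T)) * g k"
      using units by simp
    also have "(1 - T) * g k = g j - T * g i"
      using sat by simp
    then have "(S * (1 - T)) * g k = S * (g j - T * g i)"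
      by (simp only: mult.assoc)
    also have "\<dots> = (S * (1 - T)) * p + S * (of_int x - T * of_int z) * y"
      using g [OF that(1)] g [OF that(2)] by (simp add: algebra_simps)
    also have "\<dots> = p + of_int (s * (x - t * z) mod n) * y"
      using units by (simp add: of_int_mod T_def S_def)
    finally show ?thesis .
  qed
  show ?thesis
    using A 1 2 3 unfolding r
    by (cases "map_of A i"; cases "map_of A k"; cases "map_of A j") auto
qed

lemma fold_learn_sound:
  assumes "\<forall>r \<in> set rels. satisfies T g r" "\<forall>(c, x) \<in> set A. g c = p + of_int x * y"
  shows "\<forall>(c, x) \<in> set (fold (learn n t u s) rels A). g c = p + of_int x * y"
  using assms
proof (induction rels arbitrary: A)
  case (Cons r rels)
  then show ?case
    using learn_sound [of g r A p y] by simp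
qed simp

lemma relations_labels:
  "alternating w \<Longrightarrow> w \<noteq> [] \<Longrightarrow> (i, k, j) \<in> set (relations e w) \<Longrightarrow> {i, k, j} \<subseteq> insert e (fst ` set w)"
proof (induction w rule: alternating.induct)
  case (2 c ov pos k' ov' pos' w)
  then show ?case
    by (cases w) (auto split: if_splits)
qed auto

text \<open>A colouring is determined by \<open>g a\<close> and \<open>y = g b - g a\<close>. In
  these terms the relations become \<open>residual * y = 0\<close>; together with
  \<open>n * y = 0\<close> this amounts to \<open>d * y = 0\<close>. The integers that kill every
  such \<open>y\<close> are the multiples of \<open>d\<close>.\<close>

lemma kills_iff_torsion:
  assumes "torsion n t u s a b w d"
  shows "kills T U (of_int m) w \<longleftrightarrow> d dvd m"
proof -
  let ?e = "fst (hd w)"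
  define rels where "rels = relations ?e w"
  define A where "A = solution n t u s a b w"
  define v where "v c = the (map_of A c)" for c
  have w: "w \<noteq> []" "alternating w" and ab: "a \<noteq> b" "a \<in> fst ` set w" "b \<in> fst ` set w"
    and labels: "fst ` set w \<subseteq> fst ` set A"
    and d: "fold gcd (map (residual t A) rels) n = d"
    using assms by (simp_all add: torsion_def divisor_def rels_def A_def split: if_splits)
  have A: "A = fold (learn n t u s) (rels @ rels @ rels) [(a, 0), (b, 1)]"
    by (simp add: A_def solution_def rels_def Let_def)
  have map_of_A: "map_of A c = Some (v c)" if "c \<in> fst ` set w" for c
    using that labels map_of_eq_None_iff [of A c] by (cases "map_of A c") (auto simp: v_def)
  have e: "?e \<in> fst ` set w"
    using w by simp
  have travel: "travel T U g w x (g ?e) \<longleftrightarrow> x = g ?e \<and> (\<forall>r \<in> set rels. satisfies T g r)" for g x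
    unfolding rels_def by (rule travel_alternating [OF units(1) w(2,1)])
  have rels_labels: "i \<in> fst ` set w" "k \<in> fst ` set w" "j \<in> fst ` set w" if "(i, k, j) \<in> set rels" for i k j
    using relations_labels [OF w(2,1) that [unfolded rels_def]] e by auto
  have dvd: "d dvd n" "\<And>r. r \<in> set rels \<Longrightarrow> d dvd residual t A r"
    using fold_gcd_dvd [of "map (residual t A) rels" n] by (auto simp: d)
  show ?thesis
  proof
    assume "d dvd m"
    show "kills T U (of_int m) w"
      unfolding kills_def
    proof (intro allI impI ballI)
      fix x g c
      assume tr: "travel T U g w x x" and c: "c \<in> fst ` set w"
      have x: "x = g ?e"
        using tr w by (cases w rule: alternating.cases) auto
      then have sat: "\<forall>r \<in> set rels. satisfies T g r"
        using tr travel by simp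
      let ?y = "g b - g a"
      have "\<forall>(c, z) \<in> set A. g c = g a + of_int z * ?y"
        unfolding A by (rule fold_learn_sound) (use sat in auto)
      then have g: "g c = g a + of_int (v c) * ?y" if "c \<in> fst ` set w" for c
        using map_of_SomeD [OF map_of_A [OF that]] by auto
      have "of_int (residual t A r) * ?y = 0" if "r \<in> set rels" for r
      proof -
        obtain i k j where r: "r = (i, k, j)"
          by (cases r) auto
        note g' = rels_labels [OF that [unfolded r], THEN g]
        have expand: "of_int (residual t A r) * y =
            (p + of_int (v j) * y) - T * (p + of_int (v i) * y) - (1 - T) * (p + of_int (v k) * y)" for p y
          by (simp add: r T_def algebra_simps flip: v_def)
        have "of_int (residual t A r) * ?y = g j - T * g i - (1 - T) * g k"
          using expand [of ?y "g a"] by (simp only: g' [symmetric])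
        then show ?thesis
          using sat that by (auto simp: satisfies_def r)
      qed
      moreover have "of_int n * ?y = 0"
        using zero [of n] by simp
      ultimately have "of_int d * ?y = 0"
        unfolding d [symmetric] by (intro of_int_fold_gcd_mult_eq_0) auto
      moreover obtain q where "m = q * d"
        using \<open>d dvd m\<close> by (metis dvd_def mult.commute)
      ultimately have m: "of_int m * ?y = 0"
        by (simp add: mult.assoc)
      have "g c - x = (g a + of_int (v c) * ?y) - (g a + of_int (v ?e) * ?y)"
        unfolding x by (simp only: g [OF c, symmetric] g [OF e, symmetric])
      also have "\<dots> = of_int (v c - v ?e) * ?y"
        by (simp add: algebra_simps)
      finally have "of_int m * (g c - x) = of_int (v c - v ?e) * (of_int m * ?y)"
        by (simp add: ac_simps)
      then show "of_int m * (g c - x) = 0"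
        unfolding m by simp
    qed
  next
    assume kills: "kills T U (of_int m) w"
    \<comment> \<open>The extreme colouring has difference \<open>y = n div d\<close>. It satisfies
      all relations because \<open>d\<close> divides the residuals, and \<open>m\<close> kills it
      only if \<open>n\<close> divides \<open>m * q\<close>, that is, if \<open>d\<close> divides
      \<open>m\<close>.\<close>
    define q where "q = n div d"
    have n: "n = d * q" "q \<noteq> 0"
      using dvd(1) pos by (auto simp: q_def dvd_div_eq_0_iff)
    define g where "g c = (of_int (v c * q) :: 'a)" for c
    have "satisfies T g r" if "r \<in> set rels" for r
    proof -
      obtain i k j where r: "r = (i, k, j)"
        by (cases r) auto
      have "n dvd residual t A r * q"
        using dvd(2) [OF that] n by simp
      then have "(of_int (residual t A r * q) :: 'a) = 0"
        by (simp only: zero)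
      then show ?thesis
        by (simp add: satisfies_def r g_def T_def algebra_simps flip: v_def)
    qed
    then have "travel T U g w (g ?e) (g ?e)"
      using travel by blast
    then have "of_int m * (g b - g ?e) = 0" "of_int m * (g a - g ?e) = 0"
      using kills ab unfolding kills_def by blast+
    then have "of_int m * (g b - g ?e) - of_int m * (g a - g ?e) = 0"
      by simp
    moreover have "v a = 0" "v b = 1"
      using map_of_fold_learn [of "[(a, 0), (b, 1)]" a 0 n t u s "rels @ rels @ rels"]
        map_of_fold_learn [of "[(a, 0), (b, 1)]" b 1 n t u s "rels @ rels @ rels"] ab(1)
      by (simp_all add: v_def A)
    ultimately have "(of_int (m * q) :: 'a) = 0"
      by (simp add: g_def algebra_simps)
    then have "d * q dvd m * q"
      by (simp only: zero n(1))
    then show "d dvd m"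
      using n(2) by simp
  qed
qed

end

context residues_modulo
begin

lemma kills_of_int_iff:
  "torsion n t u s a b w d \<Longrightarrow> kills (of_int t :: 'a) (of_int u) (of_int m) w \<longleftrightarrow> d dvd m"
  using kills_iff_torsion unfolding T_def U_def by blast

end

section \<open>A mirror-invariant test over the chosen residues\<close>

definition annihilates :: "'a::comm_ring_1 itself \<Rightarrow> int \<Rightarrow> int \<Rightarrow> int \<Rightarrow> gauss_code \<Rightarrow> bool" where
  "annihilates ring t u m w \<longleftrightarrow>
     kills_both (of_int t :: 'a) (of_int u) (of_int m) w \<and>
     kills_both (of_int t :: 'a) (of_int u) (of_int m) (mirror w)"

lemma annihilates_knot_type:
  assumes "knot_type w = knot_type w'" "knot_diagram w'" "(of_int t :: 'a::comm_ring_1) * of_int u = 1"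
  shows "annihilates TYPE('a) t u m w \<longleftrightarrow> annihilates TYPE('a) t u m w'"
proof -
  have "w' \<in> knot_type w"
    using assms(1,2) by (simp add: knot_type_def)
  then consider "isotopic w w'" | "isotopic (mirror w) w'"
    by (auto simp: knot_type_def)
  then show ?thesis
  proof cases
    case 1
    show ?thesis
      using kills_both_isotopic [OF 1 assms(3)] kills_both_isotopic [OF isotopic_mirror [OF 1] assms(3)]
      by (simp add: annihilates_def)
  next
    case 2
    show ?thesis
      using kills_both_isotopic [OF 2 assms(3)] kills_both_isotopic [OF isotopic_mirror [OF 2] assms(3)]
      by (auto simp: annihilates_def)
  qed
qed

text \<open>A parameter is \<open>(t, u, s, s')\<close> where \<open>u\<close>, \<open>s\<close>, \<open>s'\<close> are the inverses of \<open>t\<close>, \<open>1 - t\<close>,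
  \<open>1 - u\<close>.\<close>

fun torsion_test ::
  "int \<Rightarrow> int \<times> int \<times> int \<times> int \<Rightarrow> nat \<times> nat \<Rightarrow> int \<Rightarrow> gauss_code \<Rightarrow> bool" where
  "torsion_test n (t, u, s, s') (a, b) d w \<longleftrightarrow>
     torsion n t u s a b w d \<and> torsion n u t s' a b w d \<and>
     torsion n t u s a b (rotate1 (mirror w)) d \<and> torsion n u t s' a b (rotate1 (mirror w)) d"

type_synonym residue = 2187185

abbreviation modulus :: int where
  "modulus \<equiv> 2187185"

text \<open>The modulus is \<open>5 * 7 * 11 * 13 * 19 * 23\<close>. The three values of \<open>t\<close> were found by a search; they are
  such that the triples of greatest common divisors of the modulus and \<open>\<Delta>(t)\<close>, where \<open>\<Delta>\<close> is the
  Alexander polynomial, are different for all knots of the table.\<close>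

definition parameters :: "(int \<times> int \<times> int \<times> int) list" where
  "parameters = [
     (1936304, 100449, 1384128, 803058),
     (2005852, 1529798, 520134, 1667052),
     (1516969, 562379, 446583, 1740603)]"

lemma parameters_inverse:
  "\<forall>(t, u, s, s') \<in> set parameters.
     modulus dvd t * u - 1 \<and> modulus dvd s * (1 - t) - 1 \<and> modulus dvd s' * (1 - u) - 1"
  by (simp add: parameters_def)

lemma of_int_residue_eq_0_iff: "(of_int k :: residue) = 0 \<longleftrightarrow> modulus dvd k"
  by (simp add: of_int_eq_0_iff_char_dvd)

lemma residues_modulo_parameters:
  assumes "(t, u, s, s') \<in> set parameters"
  shows "residues_modulo TYPE(residue) modulus t u s" and "residues_modulo TYPE(residue) modulus u t s'"
proof -
  have "modulus dvd t * u - 1" "modulus dvd s * (1 - t) - 1" "modulus dvd s' * (1 - u) - 1"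
    using parameters_inverse assms by fast+
  then show "residues_modulo TYPE(residue) modulus t u s" "residues_modulo TYPE(residue) modulus u t s'"
    by (unfold_locales; simp only: of_int_residue_eq_0_iff mult.commute [of u t]; simp)+
qed

lemma annihilates_iff_torsion_test:
  assumes "(t, u, s, s') \<in> set parameters"
    and "torsion_test modulus (t, u, s, s') ab d w"
  shows "annihilates TYPE(residue) t u m w \<longleftrightarrow> d dvd m"
proof -
  obtain a b where ab: "ab = (a, b)"
    by (cases ab) auto
  interpret tu: residues_modulo modulus t u s "TYPE(residue)"
    by (rule residues_modulo_parameters [OF assms(1)])
  interpret ut: residues_modulo modulus u t s' "TYPE(residue)"
    by (rule residues_modulo_parameters [OF assms(1)])
  have "(of_int t :: residue) * of_int u = 1" "(of_int u :: residue) * of_int t = 1"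
    using tu.units ut.units by (simp_all add: tu.T_def tu.U_def ut.T_def ut.U_def)
  \<comment> \<open>The mirror image of a code that starts with an over-passage starts with an
    under-passage. \<open>torsion_test\<close> therefore rotates it into the form that
    \<open>alternating\<close> demands, which does not affect \<open>kills\<close>.\<close>
  note rotate = kills_rotate1 [OF this(1)] kills_rotate1 [OF this(2)]
  have tests: "torsion modulus t u s a b w d" "torsion modulus u t s' a b w d"
    "torsion modulus t u s a b (rotate1 (mirror w)) d" "torsion modulus u t s' a b (rotate1 (mirror w)) d"
    using assms(2) by (simp_all add: ab)
  show ?thesis
    using tu.kills_of_int_iff [OF tests(1), of m] ut.kills_of_int_iff [OF tests(2), of m]
      tu.kills_of_int_iff [OF tests(3), of m] ut.kills_of_int_iff [OF tests(4), of m]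
    unfolding annihilates_def kills_both_def rotate by blast
qed

text \<open>The two generators of the module of colourings and, for each parameter, the order of its
  torsion.\<close>

definition torsion_table :: "((nat \<times> nat) \<times> (nat \<times> nat) \<times> int list) list" where
  "torsion_table = [
    ((3, 1), (1, 2), [1, 13, 1]),
    ((4, 1), (1, 2), [5, 1, 5]),
    ((5, 1), (1, 2), [55, 11, 5]),
    ((5, 2), (1, 2), [7, 1, 77]),
    ((6, 1), (1, 2), [1, 385, 1]),
    ((6, 2), (1, 2), [1, 19, 1]),
    ((6, 3), (1, 2), [1, 7, 13]),
    ((7, 1), (1, 2), [7, 1, 7]),
    ((7, 2), (1, 2), [1, 5, 1]),
    ((7, 3), (1, 3), [1, 1, 247]),
    ((7, 4), (1, 4), [5, 19, 5]),
    ((7, 5), (1, 2), [1, 7, 23]),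
    ((7, 6), (1, 2), [1, 5, 19]),
    ((7, 7), (1, 2), [133, 1, 7]),
    ((8, 1), (1, 2), [1, 1, 299]),
    ((8, 2), (1, 2), [19, 1, 1]),
    ((8, 3), (1, 3), [1, 1, 19]),
    ((8, 4), (1, 3), [13, 1, 1]),
    ((8, 6), (1, 2), [11, 23, 1]),
    ((8, 7), (1, 2), [1, 23, 1]),
    ((8, 8), (1, 2), [65, 5, 5]),
    ((8, 9), (1, 8), [115, 7, 1045]),
    ((8, 11), (1, 2), [1, 5005, 1]),
    ((8, 12), (1, 2), [1, 1, 11]),
    ((8, 13), (1, 2), [11, 1, 1]),
    ((8, 14), (1, 2), [23, 1, 1])]"

fun tests_pass ::
  "((nat \<times> nat) \<times> gauss_code) list \<Rightarrow> nat \<Rightarrow> ((nat \<times> nat) \<times> (nat \<times> nat) \<times> int list) list \<Rightarrow> bool" where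
  "tests_pass tbl i [] \<longleftrightarrow> True"
| "tests_pass tbl i ((k, ab, ds) # xs) \<longleftrightarrow>
     torsion_test modulus (parameters ! i) ab (ds ! i) (the (map_of tbl k)) \<and> tests_pass tbl i xs"

lemma tests_passD:
  "tests_pass tbl i xs \<Longrightarrow> (k, ab, ds) \<in> set xs \<Longrightarrow>
     torsion_test modulus (parameters ! i) ab (ds ! i) (the (map_of tbl k))"
  by (induction tbl i xs rule: tests_pass.induct) auto

lemma tests_pass_0: "tests_pass rolfsen_table 0 torsion_table"
  by code_simp

lemma tests_pass_1: "tests_pass rolfsen_table 1 torsion_table"
  by code_simp

lemma tests_pass_2: "tests_pass rolfsen_table 2 torsion_table"
  by code_simp

text \<open>The empty code has no arcs to serve as generators. Every scalar annihilates it, so its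
  divisors are 1.\<close>

definition torsion_table_with_unknot :: "((nat \<times> nat) \<times> (nat \<times> nat) \<times> int list) list" where
  "torsion_table_with_unknot = ((0, 1), (0, 0), [1, 1, 1]) # torsion_table"

lemma annihilates_rolfsen:
  assumes "(k, ab, ds) \<in> set torsion_table_with_unknot" "i < 3" "parameters ! i = (t, u, s, s')"
  shows "annihilates TYPE(residue) t u m (the (map_of rolfsen_table k)) \<longleftrightarrow> ds ! i dvd m"
proof (cases "(k, ab, ds) \<in> set torsion_table")
  case True
  have "i = 0 \<or> i = 1 \<or> i = 2"
    using assms(2) by linarith
  then have "tests_pass rolfsen_table i torsion_table"
    using tests_pass_0 tests_pass_1 tests_pass_2 by (elim disjE) simp_all
  then have "torsion_test modulus (t, u, s, s') ab (ds ! i) (the (map_of rolfsen_table k))"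
    using tests_passD True unfolding assms(3) [symmetric] by blast
  moreover have "(t, u, s, s') \<in> set parameters"
    using assms(2,3) nth_mem [of i parameters] by (simp add: parameters_def)
  ultimately show ?thesis
    by (intro annihilates_iff_torsion_test)
next
  case False
  then have k: "k = (0, 1)" and ds: "ds = [1, 1, 1]"
    using assms(1) by (simp_all add: torsion_table_with_unknot_def)
  have "ds ! i = 1"
    unfolding ds using assms(2) by (auto simp: nth_Cons split: nat.split)
  moreover have "the (map_of rolfsen_table k) = []"
    by (simp add: k rolfsen_table_def)
  ultimately show ?thesis
    by (simp add: annihilates_def kills_both_def kills_def)
qed

section \<open>Separation of the knots of the table\<close>

lemma map_fst_torsion_table: "map fst torsion_table_with_unknot = map fst rolfsen_table"
  by (simp only: torsion_table_with_unknot_def torsion_table_def rolfsen_table_def list.map fst_conv)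

lemma torsion_table_nonneg:
  "\<forall>(k, ab, ds) \<in> set torsion_table_with_unknot. length ds = 3 \<and> (\<forall>d \<in> set ds. d \<ge> 0)"
  by (simp add: torsion_table_with_unknot_def torsion_table_def)

lemma torsion_table_inj: "inj_on (\<lambda>(k, ab, ds). ds) (set torsion_table_with_unknot)"
proof -
  have "distinct (map (\<lambda>(k, ab, ds). ds) torsion_table_with_unknot)"
    by (simp add: torsion_table_with_unknot_def torsion_table_def)
  then show ?thesis
    by (simp only: distinct_map)
qed

text \<open>For each parameter a knot type determines the set of annihilating integers and hence its
  nonnegative generator. The triples of generators differ from knot to knot.\<close>

lemma rolfsen_inj: "inj_on (\<lambda>k. knot_type (the (map_of rolfsen_table k))) (fst ` set rolfsen_table)"
proof (rule inj_onI)
  fix k k'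
  assume k: "k \<in> fst ` set rolfsen_table" "k' \<in> fst ` set rolfsen_table"
    and eq: "knot_type (the (map_of rolfsen_table k)) = knot_type (the (map_of rolfsen_table k'))"
  have "fst ` set rolfsen_table = fst ` set torsion_table_with_unknot"
    using map_fst_torsion_table by (metis list.set_map)
  then obtain ab ds ab' ds' where mem: "(k, ab, ds) \<in> set torsion_table_with_unknot"
    "(k', ab', ds') \<in> set torsion_table_with_unknot"
    using k by (metis (no_types, lifting) imageE prod.collapse)
  have props: "length ds = 3" "length ds' = 3" "\<forall>d \<in> set ds. d \<ge> 0" "\<forall>d \<in> set ds'. d \<ge> 0"
    using mem torsion_table_nonneg by fastforce+
  have "ds ! i = ds' ! i" if i: "i < 3" for i
  proof -
    obtain t u s s' where p: "parameters ! i = (t, u, s, s')"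
      by (metis prod_cases4)
    have par: "(t, u, s, s') \<in> set parameters"
      using i p nth_mem [of i parameters] by (simp add: parameters_def)
    interpret residues_modulo modulus t u s "TYPE(residue)"
      by (rule residues_modulo_parameters [OF par])
    have "(of_int t :: residue) * of_int u = 1"
      using units by (simp add: T_def U_def)
    then have same: "ds ! i dvd m \<longleftrightarrow> ds' ! i dvd m" for m
      using annihilates_knot_type [OF eq rolfsen_table_diagrams [OF k(2)]]
        annihilates_rolfsen [OF mem(1) i p] annihilates_rolfsen [OF mem(2) i p] by blast
    \<comment> \<open>Each divisor annihilates its own diagram and therefore the other one;
      nonnegativity then excludes a difference in sign.\<close>
    have "ds ! i dvd ds' ! i" "ds' ! i dvd ds ! i"
      using same [of "ds ! i"] same [of "ds' ! i"] by simp_all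
    moreover have "ds ! i \<ge> 0" "ds' ! i \<ge> 0"
      using props i by simp_all
    ultimately show ?thesis
      by (intro zdvd_antisym_nonneg)
  qed
  then have "ds = ds'"
    using props by (intro nth_equalityI) auto
  then have "(k, ab, ds) = (k', ab', ds')"
    using inj_onD [OF torsion_table_inj _ mem] by simp
  then show "k = k'"
    by simp
qed

section \<open>The tie knots\<close>

subsection \<open>Enumeration of the tie sequences\<close>

lemma with_directions_Nil [simp]: "with_directions [] = []"
  by (simp add: with_directions_def)

lemma with_directions_Cons [simp]:
  "with_directions (x # w) = (x, if even (length w) then Out else In) # with_directions w"
proof -
  have "[0..<length (x # w)] = 0 # map Suc [0..<length w]"
    by (simp add: upt_conv_Cons map_Suc_upt del: upt_Suc)
  then show ?thesis
    by (simp add: with_directions_def del: upt_Suc)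
qed

lemma length_with_directions [simp]: "length (with_directions w) = length w"
  by (simp add: with_directions_def)

lemma map_fst_with_directions [simp]: "map fst (with_directions w) = w"
  by (induction w) auto

lemma with_directions_inj: "inj with_directions"
  by (metis injI map_fst_with_directions)

lemma with_directions_append:
  "\<exists>ps'. with_directions (ps @ [x, y, z]) = ps' @ [(x, Out), (y, In), (z, Out)]"
  by (induction ps) (auto intro: exI [of _ "_ # _"])

lemma successively_with_directions:
  "successively (\<lambda>m m'. snd m \<noteq> snd m') (with_directions w)"
  "successively (\<lambda>m m'. fst m \<noteq> fst m') (with_directions w) \<longleftrightarrow> successively (\<noteq>) w"
proof -
  show "successively (\<lambda>m m'. snd m \<noteq> snd m') (with_directions w)"
  proof (induction w rule: induct_list012)
    case (3 x y w)
    then show ?case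
      by simp
  qed auto
  show "successively (\<lambda>m m'. fst m \<noteq> fst m') (with_directions w) \<longleftrightarrow> successively (\<noteq>) w"
    using successively_map [of "(\<noteq>)" fst "with_directions w"] by simp
qed

text \<open>\<open>with_directions\<close> counts back from a final \<open>Out\<close>, so the
  induction adds moves at the front, each opposite to its successor.\<close>

lemma with_directions_if_alternating:
  assumes "successively (\<lambda>m m'. snd m \<noteq> snd m') ms" "snd (last ms) = Out" "ms \<noteq> []"
  shows "with_directions (map fst ms) = ms"
  using assms
proof (induction ms rule: induct_list012)
  case (3 m m' ms)
  have "with_directions (map fst (m' # ms)) = m' # ms"
    using 3 by simp
  moreover have "snd m = Out \<longleftrightarrow> snd m' = In"
    using 3(3) by (cases "snd m"; cases "snd m'") auto
  ultimately show ?case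
    by (cases m; cases m'; cases "snd m") (auto split: if_splits)
qed (auto simp: prod_eq_iff)

text \<open>Words grow at the front because the last three letters are prescribed. The index counts
  the letters before these, so indices below 7 give at most 9 moves. The condition on the first
  letter has to wait until the word is complete.\<close>

primrec tie_words :: "nat \<Rightarrow> region list list" where
  "tie_words 0 = [[L, R, C], [R, L, C]]"
| "tie_words (Suc n) =
     concat (map (\<lambda>w. map (\<lambda>x. x # w) (filter (\<lambda>x. x \<noteq> hd w) [L, R, C])) (tie_words n))"

lemma set_tie_words:
  "w \<in> set (tie_words n) \<longleftrightarrow> length w = n + 3 \<and> successively (\<noteq>) w \<and>
     (\<exists>ps. w = ps @ [L, R, C] \<or> w = ps @ [R, L, C])"
proof (induction n arbitrary: w)
  case 0
  show ?case
    by (auto simp: length_Suc_conv numeral_3_eq_3 append_eq_Cons_conv)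
next
  case (Suc n)
  have *: "w \<in> set (tie_words (Suc n)) \<longleftrightarrow> (\<exists>x v. w = x # v \<and> v \<in> set (tie_words n) \<and> x \<noteq> hd v)"
  proof
    assume "\<exists>x v. w = x # v \<and> v \<in> set (tie_words n) \<and> x \<noteq> hd v"
    then obtain x v where "w = x # v" "v \<in> set (tie_words n)" "x \<noteq> hd v"
      by blast
    then show "w \<in> set (tie_words (Suc n))"
      by (cases x) (auto intro!: bexI [of _ v])
  qed (auto split: if_splits)
  show ?case
  proof (cases w)
    case (Cons x v)
    have "(\<exists>ps. w = ps @ [L, R, C] \<or> w = ps @ [R, L, C]) \<longleftrightarrow>
        (\<exists>ps. v = ps @ [L, R, C] \<or> v = ps @ [R, L, C])" if "length v = n + 3"
      using that by (auto simp: Cons Cons_eq_append_conv)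
    then show ?thesis
      unfolding * Suc.IH by (cases v) (auto simp: Cons)
  qed (simp add: *)
qed

lemma short_tie_sequences_eq:
  "short_tie_sequences =
     with_directions ` set (filter (\<lambda>w. hd w = L) (concat (map tie_words [0..<7])))"
    (is "_ = with_directions ` ?W")
proof (intro equalityI subsetI)
  fix ms
  assume "ms \<in> short_tie_sequences"
  then have tie: "tie_sequence ms" and len: "length ms \<le> 9"
    by (auto simp: short_tie_sequences_def)
  then obtain ps where ps: "ms = ps @ [(L, Out), (R, In), (C, Out)] \<or> ms = ps @ [(R, Out), (L, In), (C, Out)]"
    unfolding tie_sequence_def by blast
  let ?w = "map fst ms"
  have ms: "with_directions ?w = ms"
    using tie ps by (intro with_directions_if_alternating) (auto simp: tie_sequence_def)
  have "?w \<in> set (tie_words (length ms - 3))"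
    unfolding set_tie_words using ps tie successively_with_directions(2) [of ?w]
    by (auto simp: ms tie_sequence_def)
  moreover have "length ms - 3 < 7"
    using len by simp
  moreover have "hd ?w = L"
    using tie by (simp add: tie_sequence_def hd_map)
  ultimately have "?w \<in> ?W"
    by auto
  then show "ms \<in> with_directions ` ?W"
    using ms by (metis imageI)
next
  fix ms
  assume "ms \<in> with_directions ` ?W"
  then obtain w n where w: "ms = with_directions w" "w \<in> set (tie_words n)" "hd w = L" "n < 7"
    by auto
  then have len: "length w = n + 3" and succ: "successively (\<noteq>) w"
    and ends: "\<exists>ps. w = ps @ [L, R, C] \<or> w = ps @ [R, L, C]"
    by (auto simp: set_tie_words)
  have "\<exists>ps. ms = ps @ [(L, Out), (R, In), (C, Out)] \<or> ms = ps @ [(R, Out), (L, In), (C, Out)]"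
    using ends with_directions_append unfolding w(1) by metis
  moreover have "fst (hd ms) = L"
    using w(1,3) len by (cases w) auto
  ultimately show "ms \<in> short_tie_sequences"
    using w len succ successively_with_directions [of w]
    by (auto simp: short_tie_sequences_def tie_sequence_def)
qed

subsection \<open>Certificates\<close>

text \<open>For \<open>n\<close> moves every list opens with \<open>(2 * n, Bigon 3)\<close>: the
  arc crossed by the tuck runs over the end of the active strand at \<open>t3\<close> and then over
  the straight strand at crossing \<open>n - 2\<close>. If crossing \<open>n - 3\<close> is on the
  straight strand too, it forms a second bigon with \<open>t2\<close>. If it is on the neck loop, as
  when the fourth-last region is \<open>C\<close>, a triangle move follows the first bigon
  instead.\<close>

definition certificates_one :: "certificate list" where
  "certificates_one = [
    ((0, 1), [
      ([L, R, C],
       [(6, Bigon 3), (2, Bigon 2), (1, Kink), (0, Kink)]),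
      ([L, C, R, L, C],
       [(10, Bigon 3), (1, Triangle 2 4), (5, Bigon 2), (4, Bigon 1), (0, Kink), (0, Kink)]),
      ([L, C, L, R, C],
       [(10, Bigon 3), (2, Triangle 3 2), (11, Bigon 3), (2, Bigon 1), (1, Kink), (0, Kink)]),
      ([L, R, C, L, R, C],
       [(12, Bigon 3), (1, Triangle 2 5), (5, Bigon 5), (4, Kink), (7, Bigon 2), (1, Kink), (0, Kink)]),
      ([L, R, C, R, L, C],
       [(12, Bigon 3), (1, Triangle 2 6), (5, Bigon 4), (4, Kink), (7, Bigon 2), (1, Kink), (0, Kink)]),
      ([L, R, L, C, R, L, C],
       [(14, Bigon 3), (1, Triangle 4 6), (7, Bigon 4), (4, Kink), (9, Bigon 3), (2, Kink), (1, Kink), (0, Kink)]),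
      ([L, R, L, C, L, R, C],
       [(14, Bigon 3), (1, Triangle 4 5), (7, Bigon 5), (4, Kink), (9, Bigon 3), (2, Kink), (1, Kink), (0, Kink)]),
      ([L, R, L, R, C, L, R, C],
       [(16, Bigon 3), (1, Triangle 4 7), (7, Bigon 7), (6, Kink), (11, Bigon 4), (3, Kink), (2, Kink), (1, Kink), (0, Kink)]),
      ([L, R, L, R, C, R, L, C],
       [(16, Bigon 3), (1, Triangle 4 8), (7, Bigon 6), (6, Kink), (11, Bigon 4), (3, Kink), (2, Kink), (1, Kink), (0, Kink)]),
      ([L, R, L, R, L, C, R, L, C],
       [(18, Bigon 3), (1, Triangle 6 8), (9, Bigon 6), (6, Kink), (13, Bigon 5), (4, Kink), (3, Kink), (2, Kink), (1, Kink), (0, Kink)]),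
      ([L, R, L, R, L, C, L, R, C],
       [(18, Bigon 3), (1, Triangle 6 7), (9, Bigon 7), (6, Kink), (13, Bigon 5), (4, Kink), (3, Kink), (2, Kink), (1, Kink), (0, Kink)])]),
    ((3, 1), [
      ([L, R, L, C],
       [(8, Bigon 3), (2, Bigon 4), (0, Mirror), (0, Rename [1, 0, 0, 3, 2])]),
      ([L, C, R, C, L, R, C],
       [(14, Bigon 3), (1, Triangle 2 7), (5, Bigon 7), (6, Kink), (9, Bigon 2), (0, Rename [1, 3, 2])]),
      ([L, C, R, C, R, L, C],
       [(14, Bigon 3), (1, Triangle 2 8), (5, Bigon 6), (6, Kink), (9, Bigon 2), (0, Rename [1, 3, 2])]),
      ([L, C, L, C, R, L, C],
       [(14, Bigon 3), (1, Triangle 4 6), (7, Bigon 4), (6, Bigon 3), (6, Kink), (1, Rename [0, 2, 1, 3])]),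
      ([L, C, L, C, L, R, C],
       [(14, Bigon 3), (2, Triangle 5 4), (15, Bigon 5), (4, Bigon 3), (3, Kink), (1, Rename [0, 2, 1, 3])]),
      ([L, C, R, L, C, R, L, C],
       [(16, Bigon 3), (1, Triangle 4 8), (7, Bigon 6), (6, Kink), (11, Bigon 3), (7, Kink), (0, Mirror), (0, Rename [1, 3, 2])]),
      ([L, C, L, R, C, L, R, C],
       [(16, Bigon 3), (1, Triangle 4 7), (7, Bigon 7), (6, Kink), (11, Bigon 4), (7, Kink), (0, Mirror), (0, Rename [1, 3, 2])]),
      ([L, C, R, L, C, L, R, C],
       [(16, Bigon 3), (1, Triangle 4 7), (7, Bigon 7), (6, Kink), (11, Bigon 3), (7, Kink), (0, Mirror), (0, Rename [1, 3, 2])]),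
      ([L, C, L, R, C, R, L, C],
       [(16, Bigon 3), (1, Triangle 4 8), (7, Bigon 6), (6, Kink), (11, Bigon 4), (7, Kink), (0, Mirror), (0, Rename [1, 3, 2])]),
      ([L, C, R, L, R, C, L, R, C],
       [(18, Bigon 3), (1, Triangle 4 9), (7, Bigon 9), (8, Kink), (13, Bigon 4), (9, Kink), (7, Kink), (0, Rename [1, 3, 2])]),
      ([L, C, R, L, R, C, R, L, C],
       [(18, Bigon 3), (1, Triangle 4 10), (7, Bigon 8), (8, Kink), (13, Bigon 4), (9, Kink), (7, Kink), (0, Rename [1, 3, 2])]),
      ([L, C, L, R, L, C, R, L, C],
       [(18, Bigon 3), (1, Triangle 6 8), (9, Bigon 6), (6, Kink), (13, Bigon 5), (9, Kink), (7, Kink), (0, Rename [1, 3, 2])]),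
      ([L, C, L, R, L, C, L, R, C],
       [(18, Bigon 3), (1, Triangle 6 7), (9, Bigon 7), (6, Kink), (13, Bigon 5), (9, Kink), (7, Kink), (0, Rename [1, 3, 2])])])]"

lemma certified_one: "certified rolfsen_table certificates_one"
  by code_simp

text \<open>A \<open>Rename\<close> list is indexed by the old labels. Entry 0, which is no label of
  the table, fills the places of crossings that have been removed.\<close>

definition certificates_two :: "certificate list" where
  "certificates_two = [
    ((4, 1), [
      ([L, R, L, R, C],
       [(10, Bigon 3), (2, Bigon 6), (1, Rename [1, 3, 0, 0, 2, 4])]),
      ([L, R, C, L, C, R, L, C],
       [(16, Bigon 3), (1, Triangle 4 8), (7, Bigon 6), (6, Kink), (11, Bigon 3), (0, Reverse), (1, Rename [2, 4, 1, 3])]),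
      ([L, R, C, R, C, L, R, C],
       [(16, Bigon 3), (1, Triangle 2 9), (5, Bigon 9), (8, Kink), (11, Bigon 2), (0, Reverse), (1, Rename [2, 4, 1, 3])]),
      ([L, R, C, L, C, L, R, C],
       [(16, Bigon 3), (1, Triangle 4 7), (7, Bigon 7), (6, Kink), (11, Bigon 3), (0, Reverse), (1, Rename [2, 4, 1, 3])]),
      ([L, R, C, R, C, R, L, C],
       [(16, Bigon 3), (1, Triangle 2 10), (5, Bigon 8), (8, Kink), (11, Bigon 2), (0, Reverse), (1, Rename [2, 4, 1, 3])]),
      ([L, R, C, L, R, C, L, R, C],
       [(18, Bigon 3), (1, Triangle 4 9), (7, Bigon 9), (8, Kink), (13, Bigon 4), (9, Kink), (1, Rename [1, 3, 2, 4])]),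
      ([L, R, C, R, L, C, R, L, C],
       [(18, Bigon 3), (1, Triangle 4 10), (7, Bigon 8), (8, Kink), (13, Bigon 3), (9, Kink), (1, Rename [1, 3, 2, 4])]),
      ([L, R, C, L, R, C, R, L, C],
       [(18, Bigon 3), (1, Triangle 4 10), (7, Bigon 8), (8, Kink), (13, Bigon 4), (9, Kink), (1, Rename [1, 3, 2, 4])]),
      ([L, R, C, R, L, C, L, R, C],
       [(18, Bigon 3), (1, Triangle 4 9), (7, Bigon 9), (8, Kink), (13, Bigon 3), (9, Kink), (1, Rename [1, 3, 2, 4])])]),
    ((5, 1), [
      ([L, C, L, R, L, C],
       [(12, Bigon 3), (2, Bigon 8), (0, Mirror), (0, Rename [1, 4, 2, 0, 0, 5, 3])]),
      ([L, C, L, C, R, C, L, R, C],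
       [(18, Bigon 3), (1, Triangle 4 9), (7, Bigon 9), (8, Kink), (13, Bigon 4), (0, Rename [1, 4, 2, 5, 3])]),
      ([L, C, L, C, R, C, R, L, C],
       [(18, Bigon 3), (1, Triangle 4 10), (7, Bigon 8), (8, Kink), (13, Bigon 4), (0, Rename [1, 4, 2, 5, 3])]),
      ([L, C, L, C, L, C, R, L, C],
       [(18, Bigon 3), (1, Triangle 6 8), (9, Bigon 6), (8, Bigon 5), (10, Kink), (1, Rename [0, 3, 1, 4, 2, 5])]),
      ([L, C, L, C, L, C, L, R, C],
       [(18, Bigon 3), (2, Triangle 7 6), (19, Bigon 7), (6, Bigon 5), (5, Kink), (1, Rename [0, 3, 1, 4, 2, 5])])]),
    ((5, 2), [
      ([L, R, L, R, L, C],
       [(12, Bigon 3), (2, Bigon 8), (0, Mirror), (2, Rename [1, 3, 5, 0, 0, 4, 2])]),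
      ([L, C, R, L, R, C],
       [(12, Bigon 3), (2, Bigon 8), (0, Mirror), (4, Rename [4, 2, 1, 0, 0, 3, 5])]),
      ([L, R, L, C, R, C, L, R, C],
       [(18, Bigon 3), (1, Triangle 4 9), (7, Bigon 9), (8, Kink), (13, Bigon 4), (2, Rename [1, 3, 5, 4, 2])]),
      ([L, R, L, C, R, C, R, L, C],
       [(18, Bigon 3), (1, Triangle 4 10), (7, Bigon 8), (8, Kink), (13, Bigon 4), (2, Rename [1, 3, 5, 4, 2])]),
      ([L, R, L, C, L, C, R, L, C],
       [(18, Bigon 3), (1, Triangle 6 8), (9, Bigon 6), (6, Kink), (13, Bigon 5), (2, Rename [1, 3, 5, 4, 2])]),
      ([L, R, L, C, L, C, L, R, C],
       [(18, Bigon 3), (1, Triangle 6 7), (9, Bigon 7), (6, Kink), (13, Bigon 5), (2, Rename [1, 3, 5, 4, 2])]),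
      ([L, C, R, C, L, C, R, L, C],
       [(18, Bigon 3), (1, Triangle 4 10), (7, Bigon 8), (8, Kink), (13, Bigon 3), (4, Rename [4, 2, 1, 3, 5])]),
      ([L, C, R, C, R, C, L, R, C],
       [(18, Bigon 3), (1, Triangle 2 11), (5, Bigon 11), (10, Kink), (13, Bigon 2), (4, Rename [4, 2, 1, 3, 5])]),
      ([L, C, R, C, L, C, L, R, C],
       [(18, Bigon 3), (1, Triangle 4 9), (7, Bigon 9), (8, Kink), (13, Bigon 3), (4, Rename [4, 2, 1, 3, 5])]),
      ([L, C, R, C, R, C, R, L, C],
       [(18, Bigon 3), (1, Triangle 2 12), (5, Bigon 10), (10, Kink), (13, Bigon 2), (4, Rename [4, 2, 1, 3, 5])])]),
    ((6, 1), [
      ([L, R, L, R, L, R, C],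
       [(14, Bigon 3), (2, Bigon 10), (3, Rename [1, 3, 6, 4, 0, 0, 2, 5])]),
      ([L, R, C, R, L, R, C],
       [(14, Bigon 3), (2, Bigon 10), (0, Mirror), (0, Reverse), (3, Rename [2, 5, 1, 3, 0, 0, 6, 4])])]),
    ((6, 2), [
      ([L, R, C, L, R, L, C],
       [(14, Bigon 3), (2, Bigon 10), (0, Mirror), (0, Reverse), (3, Rename [2, 5, 1, 4, 0, 0, 6, 3])]),
      ([L, C, L, R, L, R, C],
       [(14, Bigon 3), (2, Bigon 10), (9, Rename [3, 6, 4, 1, 0, 0, 5, 2])])]),
    ((6, 3), [
      ([L, C, R, L, R, L, C],
       [(14, Bigon 3), (2, Bigon 10), (1, Add_Bigon 4 5 True True False 2), (1, Triangle 0 4), (1, Kink), (4, Triangle 0 5), (1, Kink), (5, Rename [2, 4, 0, 5, 1, 0, 3, 6])])])]"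

lemma certified_two: "certified rolfsen_table certificates_two"
  by code_simp

text \<open>\<open>Add_Bigon\<close> reuses the labels \<open>n - 3\<close> and \<open>n - 2\<close>
  freed by the first two bigons. For 7_5, 7_6 and 7_7 two triangle moves each leave a kink; the
  kinks remove one added and one old crossing, so the other added crossing takes the place of the
  old one.\<close>

definition certificates_three :: "certificate list" where
  "certificates_three = [
    ((7, 1), [
      ([L, C, L, C, L, R, L, C],
       [(16, Bigon 3), (2, Bigon 12), (0, Mirror), (0, Rename [1, 5, 2, 6, 3, 0, 0, 7, 4])])]),
    ((7, 2), [
      ([L, R, L, R, L, R, L, C],
       [(16, Bigon 3), (2, Bigon 12), (0, Mirror), (4, Rename [1, 3, 7, 4, 6, 0, 0, 5, 2])]),
      ([L, C, R, C, R, L, R, C],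
       [(16, Bigon 3), (2, Bigon 12), (0, Mirror), (6, Rename [5, 2, 1, 3, 7, 0, 0, 4, 6])])]),
    ((7, 3), [
      ([L, R, L, C, L, R, L, C],
       [(16, Bigon 3), (2, Bigon 12), (0, Mirror), (2, Rename [1, 4, 7, 5, 2, 0, 0, 6, 3])]),
      ([L, C, L, C, R, L, R, C],
       [(16, Bigon 3), (2, Bigon 12), (0, Mirror), (6, Rename [5, 2, 6, 3, 1, 0, 0, 4, 7])])]),
    ((7, 4), [
      ([L, R, L, C, R, L, R, C],
       [(16, Bigon 3), (2, Bigon 12), (0, Mirror), (6, Rename [6, 2, 5, 3, 1, 0, 0, 4, 7])])]),
    ((7, 5), [
      ([L, C, L, R, L, R, L, C],
       [(16, Bigon 3), (2, Bigon 12), (5, Add_Bigon 5 6 True False False 2), (1, Triangle 0 6), (1, Kink), (6, Triangle 0 5), (1, Kink), (0, Mirror), (12, Rename [3, 7, 4, 1, 0, 6, 0, 2, 5])]),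
      ([L, C, R, C, L, R, L, C],
       [(16, Bigon 3), (2, Bigon 12), (0, Add_Bigon 5 6 False False False 2), (3, Triangle 6 6), (17, Kink), (8, Triangle 5 5), (15, Kink), (0, Mirror), (5, Rename [2, 5, 0, 6, 3, 1, 0, 7, 4])])]),
    ((7, 6), [
      ([L, R, C, R, L, R, L, C],
       [(16, Bigon 3), (2, Bigon 12), (3, Add_Bigon 5 6 True False False 2), (1, Triangle 0 8), (1, Kink), (8, Triangle 0 3), (1, Kink), (0, Mirror), (0, Reverse), (7, Rename [3, 6, 7, 5, 0, 1, 0, 4, 2])]),
      ([L, C, R, L, R, L, R, C],
       [(16, Bigon 3), (2, Bigon 12), (2, Add_Bigon 5 6 False False False 2), (3, Triangle 4 8), (17, Kink), (6, Triangle 7 3), (15, Kink), (0, Mirror), (7, Rename [2, 4, 0, 5, 7, 1, 0, 6, 3])])]),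
    ((7, 7), [
      ([L, R, C, L, R, L, R, C],
       [(16, Bigon 3), (2, Bigon 12), (1, Add_Bigon 5 6 True True False 2), (1, Triangle 0 5), (1, Kink), (7, Triangle 6 4), (15, Kink), (6, Rename [5, 2, 0, 3, 6, 1, 0, 4, 7])])]),
    ((8, 1), [
      ([L, R, L, R, L, R, L, R, C],
       [(18, Bigon 3), (2, Bigon 14), (5, Rename [1, 3, 8, 4, 7, 5, 0, 0, 2, 6])]),
      ([L, R, C, R, C, R, L, R, C],
       [(18, Bigon 3), (2, Bigon 14), (0, Mirror), (0, Reverse), (5, Rename [2, 6, 1, 3, 8, 4, 0, 0, 7, 5])])]),
    ((8, 2), [
      ([L, R, C, L, C, L, R, L, C],
       [(18, Bigon 3), (2, Bigon 14), (0, Mirror), (0, Reverse), (5, Rename [2, 6, 1, 5, 8, 4, 0, 0, 7, 3])]),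
      ([L, C, L, C, L, R, L, R, C],
       [(18, Bigon 3), (2, Bigon 14), (13, Rename [3, 7, 4, 8, 5, 1, 0, 0, 6, 2])])]),
    ((8, 3), [
      ([L, R, L, R, C, R, L, R, C],
       [(18, Bigon 3), (2, Bigon 14), (3, Rename [1, 4, 8, 5, 3, 6, 0, 0, 2, 7])])]),
    ((8, 4), [
      ([L, R, L, R, C, L, R, L, C],
       [(18, Bigon 3), (2, Bigon 14), (11, Rename [5, 8, 4, 1, 7, 2, 0, 0, 6, 3])]),
      ([L, C, L, R, C, R, L, R, C],
       [(18, Bigon 3), (2, Bigon 14), (0, Mirror), (0, Reverse), (3, Rename [3, 6, 2, 7, 1, 4, 0, 0, 8, 5])])])]"

lemma certified_three: "certified rolfsen_table certificates_three"
  by code_simp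

text \<open>For 8_11 three triangle moves lie between the two kinks. In its second list no bigon is
  added: the crossings 6 and 10 of the second bigon of the tie diagram are kept and removed as the
  kinks.\<close>

definition certificates_four :: "certificate list" where
  "certificates_four = [
    ((8, 6), [
      ([L, C, L, R, L, R, L, R, C],
       [(18, Bigon 3), (2, Bigon 14), (6, Add_Bigon 6 7 False True False 2), (3, Triangle 7 7), (19, Kink), (7, Triangle 0 6), (1, Kink), (0, Reverse), (6, Rename [4, 8, 3, 7, 5, 0, 1, 0, 2, 6])]),
      ([L, R, C, R, C, L, R, L, C],
       [(18, Bigon 3), (2, Bigon 14), (0, Add_Bigon 6 7 False False False 2), (3, Triangle 7 7), (19, Kink), (7, Triangle 0 6), (1, Kink), (0, Mirror), (6, Rename [6, 2, 0, 5, 7, 3, 1, 0, 8, 4])])]),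
    ((8, 7), [
      ([L, C, R, L, C, L, R, L, C],
       [(18, Bigon 3), (2, Bigon 14), (1, Add_Bigon 6 7 True True False 2), (1, Triangle 0 6), (1, Kink), (6, Triangle 0 7), (1, Kink), (7, Rename [2, 5, 0, 6, 3, 7, 1, 0, 4, 8])]),
      ([L, C, L, C, R, L, R, L, C],
       [(18, Bigon 3), (2, Bigon 14), (5, Add_Bigon 6 7 True False False 2), (1, Triangle 0 8), (1, Kink), (8, Triangle 0 5), (1, Kink), (0, Mirror), (0, Reverse), (7, Rename [8, 4, 7, 3, 6, 0, 1, 0, 5, 2])])]),
    ((8, 8), [
      ([L, C, R, L, R, L, R, L, C],
       [(18, Bigon 3), (2, Bigon 14), (3, Add_Bigon 6 7 True True False 2), (1, Triangle 0 4), (1, Kink), (4, Triangle 0 9), (1, Kink), (9, Rename [2, 4, 0, 5, 8, 6, 1, 0, 3, 7])]),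
      ([L, C, R, C, R, L, R, L, C],
       [(18, Bigon 3), (2, Bigon 14), (3, Add_Bigon 6 7 True False False 2), (1, Triangle 0 10), (1, Kink), (10, Triangle 0 3), (1, Kink), (0, Mirror), (0, Reverse), (9, Rename [7, 3, 6, 8, 5, 0, 1, 0, 4, 2])])]),
    ((8, 9), [
      ([L, C, L, R, C, L, R, L, C],
       [(18, Bigon 3), (2, Bigon 14), (11, Rename [4, 8, 5, 1, 7, 2, 0, 0, 6, 3])])]),
    ((8, 11), [
      ([L, R, L, C, L, R, L, R, C],
       [(18, Bigon 3), (2, Bigon 14), (8, Add_Bigon 6 7 False False False 2), (3, Triangle 9 5), (19, Kink), (9, Triangle 5 1), (11, Triangle 7 4), (0, Triangle 6 6), (17, Kink), (2, Rename [3, 7, 4, 8, 5, 1, 0, 0, 6, 2])]),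
      ([L, R, C, L, C, R, L, R, C],
       [(18, Bigon 3), (1, Triangle 5 9), (19, Kink), (0, Triangle 5 6), (5, Triangle 7 1), (11, Triangle 6 6), (17, Kink), (0, Mirror), (0, Reverse), (2, Rename [2, 6, 1, 5, 8, 4, 0, 0, 7, 3])])]),
    ((8, 12), [
      ([L, R, C, R, L, R, L, R, C],
       [(18, Bigon 3), (2, Bigon 14), (2, Add_Bigon 6 7 False False False 2), (3, Triangle 5 9), (19, Kink), (5, Triangle 0 8), (1, Kink), (0, Mirror), (8, Rename [5, 2, 0, 4, 6, 8, 1, 0, 7, 3])])]),
    ((8, 13), [
      ([L, R, L, C, R, L, R, L, C],
       [(18, Bigon 3), (2, Bigon 14), (5, Add_Bigon 6 7 True False False 2), (1, Triangle 0 8), (1, Kink), (8, Triangle 0 5), (1, Kink), (0, Mirror), (0, Reverse), (7, Rename [8, 4, 7, 3, 6, 0, 1, 0, 5, 2])]),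
      ([L, C, R, L, C, R, L, R, C],
       [(18, Bigon 3), (2, Bigon 14), (1, Add_Bigon 6 7 True True False 2), (1, Triangle 0 6), (1, Kink), (6, Triangle 0 7), (1, Kink), (7, Rename [2, 5, 0, 6, 3, 7, 1, 0, 4, 8])])]),
    ((8, 14), [
      ([L, R, C, L, R, L, R, L, C],
       [(18, Bigon 3), (2, Bigon 14), (2, Add_Bigon 6 7 False False False 2), (3, Triangle 5 9), (19, Kink), (5, Triangle 0 8), (1, Kink), (0, Mirror), (8, Rename [5, 2, 0, 3, 6, 8, 1, 0, 7, 4])]),
      ([L, C, R, C, L, R, L, R, C],
       [(18, Bigon 3), (2, Bigon 14), (4, Add_Bigon 6 7 False True False 2), (3, Triangle 9 5), (19, Kink), (9, Triangle 0 4), (1, Kink), (0, Reverse), (8, Rename [4, 7, 8, 6, 3, 0, 1, 0, 2, 5])])])]"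

lemma certified_four: "certified rolfsen_table certificates_four"
  by code_simp

section \<open>Assembly of the classification\<close>

definition certificates :: "certificate list" where
  "certificates = certificates_one @ certificates_two @ certificates_three @ certificates_four"

lemma certified_append: "certified tbl (cs @ cs') \<longleftrightarrow> certified tbl cs \<and> certified tbl cs'"
  by (induction tbl cs rule: certified.induct) auto

lemma certified: "certified rolfsen_table certificates"
  unfolding certificates_def certified_append
  by (intro conjI certified_one certified_two certified_three certified_four)

lemmas certificates_defs = certificates_def certificates_one_def certificates_two_def
  certificates_three_def certificates_four_def

lemma certificate_keys: "map fst certificates = map fst rolfsen_table"
  by (simp only: certificates_defs rolfsen_table_def list.map append.simps fst_conv)

lemma distinct_certificate_keys: "distinct (map fst certificates)"
  unfolding certificate_keys by (simp add: rolfsen_table_def)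

text \<open>This is the completeness of the certificates: no short tie sequence is left without an
  assigned knot.\<close>

lemma short_tie_sequences_certified:
  "short_tie_sequences = with_directions ` (\<Union>(k, rs) \<in> set certificates. fst ` set rs)"
proof -
  have "set (filter (\<lambda>w. hd w = L) (concat (map tie_words [0..<7]))) =
      set (concat (map (\<lambda>(k, rs). map fst rs) certificates))"
    by code_simp
  moreover have "\<dots> = (\<Union>(k, rs) \<in> set certificates. fst ` set rs)"
    by (auto split: prod.splits)
  ultimately show ?thesis
    unfolding short_tie_sequences_eq by simp
qed

lemma mem_short_tie_sequences_iff:
  "ms \<in> short_tie_sequences \<longleftrightarrow>
     (\<exists>k rs w. (k, rs) \<in> set certificates \<and> w \<in> fst ` set rs \<and> ms = with_directions w)"
proof -
  have *: "(\<Union>(k, rs) \<in> A. F rs) = {w. \<exists>k rs. (k, rs) \<in> A \<and> w \<in> F rs}"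
    for A :: "certificate set" and F :: "(region list \<times> (nat \<times> move) list) list \<Rightarrow> region list set"
    by auto
  show ?thesis
    unfolding short_tie_sequences_certified * by blast
qed

lemma card_short_tie_sequences: "card short_tie_sequences = 85"
proof -
  let ?ws = "filter (\<lambda>w. hd w = L) (concat (map tie_words [0..<7]))"
  have "distinct ?ws \<and> length ?ws = 85"
    by code_simp
  then show ?thesis
    unfolding short_tie_sequences_eq
    by (metis card_image distinct_card inj_on_subset subset_UNIV with_directions_inj)
qed

lemma certificate_key:
  assumes "(k, rs) \<in> set certificates"
  shows "k \<in> fst ` set rolfsen_table"
proof -
  have "fst ` set certificates = fst ` set rolfsen_table"
    using certificate_keys by (metis list.set_map)
  then show ?thesis
    using assms by force
qed

text \<open>Any sequence of this type occurs in some certificate, whose knot is then the same.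
  Injectivity on the table forces the same key, and distinct keys force the same list of
  words.\<close>

lemma sequences_of_type_rolfsen:
  assumes "((n, k), rs) \<in> set certificates"
  shows "sequences_of_type (rolfsen n k) = with_directions ` fst ` set rs"
proof (intro equalityI subsetI)
  fix ms
  assume "ms \<in> sequences_of_type (rolfsen n k)"
  then have "ms \<in> short_tie_sequences" and knot: "tie_knot ms = rolfsen n k"
    by (auto simp: sequences_of_type_def)
  then obtain n' k' rs' w where rs': "((n', k'), rs') \<in> set certificates"
    and w: "w \<in> fst ` set rs'" and ms: "ms = with_directions w"
    unfolding mem_short_tie_sequences_iff by (metis surj_pair)
  have "rolfsen n k = rolfsen n' k'"
    using knot tie_knot_if_certified [OF certified rs' w certificate_key [OF rs']] by (simp add: ms)
  then have "(n, k) = (n', k')"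
    using inj_onD [OF rolfsen_inj _ certificate_key [OF assms] certificate_key [OF rs']]
    by (simp add: rolfsen_def)
  then have "rs = rs'"
    using assms rs' distinct_certificate_keys by (metis eq_key_imp_eq_value)
  then show "ms \<in> with_directions ` fst ` set rs"
    using w ms by blast
next
  fix ms
  assume "ms \<in> with_directions ` fst ` set rs"
  then obtain w where w: "w \<in> fst ` set rs" and ms: "ms = with_directions w"
    by blast
  have "ms \<in> short_tie_sequences"
    unfolding mem_short_tie_sequences_iff using assms w ms by blast
  then show "ms \<in> sequences_of_type (rolfsen n k)"
    using tie_knot_if_certified [OF certified assms w certificate_key [OF assms]] by (simp add: sequences_of_type_def ms)
qed

lemma tie_knots: "tie_knot ` short_tie_sequences = (\<lambda>(n, k). rolfsen n k) ` fst ` set rolfsen_table"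
proof -
  \<comment> \<open>Every knot of the table has at least one certified word, hence occurs as a tie
    knot.\<close>
  have nonempty: "\<forall>(k, rs) \<in> set certificates. rs \<noteq> []"
    by (simp add: certificates_defs)
  have keys: "fst ` set rolfsen_table = fst ` set certificates"
    using certificate_keys by (metis list.set_map)
  have knot: "tie_knot (with_directions w) = (case k of (n, k) \<Rightarrow> rolfsen n k)"
    if "(k, rs) \<in> set certificates" "w \<in> fst ` set rs" for k rs w
    using tie_knot_if_certified [OF certified] certificate_key that by (cases k) simp
  show ?thesis
    unfolding keys
  proof (intro equalityI subsetI)
    fix K
    assume "K \<in> tie_knot ` short_tie_sequences"
    then obtain ms where "ms \<in> short_tie_sequences" "K = tie_knot ms"
      by blast
    then obtain k rs w where k: "(k, rs) \<in> set certificates" and w: "w \<in> fst ` set rs"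
      and K: "K = tie_knot (with_directions w)"
      unfolding mem_short_tie_sequences_iff by blast
    have "K = (\<lambda>(n, k). rolfsen n k) (fst (k, rs))"
      using knot [OF k w] K by simp
    then show "K \<in> (\<lambda>(n, k). rolfsen n k) ` fst ` set certificates"
      using k by blast
  next
    fix K
    assume "K \<in> (\<lambda>(n, k). rolfsen n k) ` fst ` set certificates"
    then obtain k rs where k: "(k, rs) \<in> set certificates" "K = (case k of (n, k) \<Rightarrow> rolfsen n k)"
      by auto
    then obtain w where w: "w \<in> fst ` set rs"
      using nonempty by (cases rs) auto
    then have "with_directions w \<in> short_tie_sequences"
      unfolding mem_short_tie_sequences_iff using k(1) w by blast
    then show "K \<in> tie_knot ` short_tie_sequences"
      using knot [OF k(1) w] k(2) by auto
  qed
qed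

lemma sequences_of_type_certified:
  "\<forall>((n, k), rs) \<in> set certificates.
     sequences_of_type (rolfsen n k) = with_directions ` fst ` set rs"
  using sequences_of_type_rolfsen by fast

theorem mainTheorem4:
  shows "card short_tie_sequences = 85 \<and>
    tie_knot ` short_tie_sequences = {
      rolfsen 0 1, rolfsen 3 1, rolfsen 4 1, rolfsen 5 1, rolfsen 5 2,
      rolfsen 6 1, rolfsen 6 2, rolfsen 6 3, rolfsen 7 1, rolfsen 7 2,
      rolfsen 7 3, rolfsen 7 4, rolfsen 7 5, rolfsen 7 6, rolfsen 7 7,
      rolfsen 8 1, rolfsen 8 2, rolfsen 8 3, rolfsen 8 4, rolfsen 8 6,
      rolfsen 8 7, rolfsen 8 8, rolfsen 8 9, rolfsen 8 11, rolfsen 8 12,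
      rolfsen 8 13, rolfsen 8 14} \<and>
    sequences_of_type (rolfsen 0 1) = with_directions ` {
      [L, R, C],
      [L, C, R, L, C],
      [L, C, L, R, C],
      [L, R, C, L, R, C],
      [L, R, C, R, L, C],
      [L, R, L, C, R, L, C],
      [L, R, L, C, L, R, C],
      [L, R, L, R, C, L, R, C],
      [L, R, L, R, C, R, L, C],
      [L, R, L, R, L, C, R, L, C],
      [L, R, L, R, L, C, L, R, C]} \<and>
    sequences_of_type (rolfsen 3 1) = with_directions ` {
      [L, R, L, C],
      [L, C, R, C, L, R, C],
      [L, C, R, C, R, L, C],
      [L, C, L, C, R, L, C],
      [L, C, L, C, L, R, C],
      [L, C, R, L, C, R, L, C],
      [L, C, L, R, C, L, R, C],
      [L, C, R, L, C, L, R, C],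
      [L, C, L, R, C, R, L, C],
      [L, C, R, L, R, C, L, R, C],
      [L, C, R, L, R, C, R, L, C],
      [L, C, L, R, L, C, R, L, C],
      [L, C, L, R, L, C, L, R, C]} \<and>
    sequences_of_type (rolfsen 4 1) = with_directions ` {
      [L, R, L, R, C],
      [L, R, C, L, C, R, L, C],
      [L, R, C, R, C, L, R, C],
      [L, R, C, L, C, L, R, C],
      [L, R, C, R, C, R, L, C],
      [L, R, C, L, R, C, L, R, C],
      [L, R, C, R, L, C, R, L, C],
      [L, R, C, L, R, C, R, L, C],
      [L, R, C, R, L, C, L, R, C]} \<and>
    sequences_of_type (rolfsen 5 1) = with_directions ` {
      [L, C, L, R, L, C],
      [L, C, L, C, R, C, L, R, C],
      [L, C, L, C, R, C, R, L, C],
      [L, C, L, C, L, C, R, L, C],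
      [L, C, L, C, L, C, L, R, C]} \<and>
    sequences_of_type (rolfsen 5 2) = with_directions ` {
      [L, R, L, R, L, C],
      [L, C, R, L, R, C],
      [L, R, L, C, R, C, L, R, C],
      [L, R, L, C, R, C, R, L, C],
      [L, R, L, C, L, C, R, L, C],
      [L, R, L, C, L, C, L, R, C],
      [L, C, R, C, L, C, R, L, C],
      [L, C, R, C, R, C, L, R, C],
      [L, C, R, C, L, C, L, R, C],
      [L, C, R, C, R, C, R, L, C]} \<and>
    sequences_of_type (rolfsen 6 1) = with_directions ` {
      [L, R, L, R, L, R, C],
      [L, R, C, R, L, R, C]} \<and>
    sequences_of_type (rolfsen 6 2) = with_directions ` {
      [L, R, C, L, R, L, C],
      [L, C, L, R, L, R, C]} \<and>
    sequences_of_type (rolfsen 6 3) = with_directions ` {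
      [L, C, R, L, R, L, C]} \<and>
    sequences_of_type (rolfsen 7 1) = with_directions ` {
      [L, C, L, C, L, R, L, C]} \<and>
    sequences_of_type (rolfsen 7 2) = with_directions ` {
      [L, R, L, R, L, R, L, C],
      [L, C, R, C, R, L, R, C]} \<and>
    sequences_of_type (rolfsen 7 3) = with_directions ` {
      [L, R, L, C, L, R, L, C],
      [L, C, L, C, R, L, R, C]} \<and>
    sequences_of_type (rolfsen 7 4) = with_directions ` {
      [L, R, L, C, R, L, R, C]} \<and>
    sequences_of_type (rolfsen 7 5) = with_directions ` {
      [L, C, L, R, L, R, L, C],
      [L, C, R, C, L, R, L, C]} \<and>
    sequences_of_type (rolfsen 7 6) = with_directions ` {
      [L, R, C, R, L, R, L, C],
      [L, C, R, L, R, L, R, C]} \<and>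
    sequences_of_type (rolfsen 7 7) = with_directions ` {
      [L, R, C, L, R, L, R, C]} \<and>
    sequences_of_type (rolfsen 8 1) = with_directions ` {
      [L, R, L, R, L, R, L, R, C],
      [L, R, C, R, C, R, L, R, C]} \<and>
    sequences_of_type (rolfsen 8 2) = with_directions ` {
      [L, R, C, L, C, L, R, L, C],
      [L, C, L, C, L, R, L, R, C]} \<and>
    sequences_of_type (rolfsen 8 3) = with_directions ` {
      [L, R, L, R, C, R, L, R, C]} \<and>
    sequences_of_type (rolfsen 8 4) = with_directions ` {
      [L, R, L, R, C, L, R, L, C],
      [L, C, L, R, C, R, L, R, C]} \<and>
    sequences_of_type (rolfsen 8 6) = with_directions ` {
      [L, C, L, R, L, R, L, R, C],
      [L, R, C, R, C, L, R, L, C]} \<and>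
    sequences_of_type (rolfsen 8 7) = with_directions ` {
      [L, C, R, L, C, L, R, L, C],
      [L, C, L, C, R, L, R, L, C]} \<and>
    sequences_of_type (rolfsen 8 8) = with_directions ` {
      [L, C, R, L, R, L, R, L, C],
      [L, C, R, C, R, L, R, L, C]} \<and>
    sequences_of_type (rolfsen 8 9) = with_directions ` {
      [L, C, L, R, C, L, R, L, C]} \<and>
    sequences_of_type (rolfsen 8 11) = with_directions ` {
      [L, R, L, C, L, R, L, R, C],
      [L, R, C, L, C, R, L, R, C]} \<and>
    sequences_of_type (rolfsen 8 12) = with_directions ` {
      [L, R, C, R, L, R, L, R, C]} \<and>
    sequences_of_type (rolfsen 8 13) = with_directions ` {
      [L, R, L, C, R, L, R, L, C],
      [L, C, R, L, C, R, L, R, C]} \<and>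
    sequences_of_type (rolfsen 8 14) = with_directions ` {
      [L, R, C, L, R, L, R, L, C],
      [L, C, R, C, L, R, L, R, C]}"
  apply (rule conjI [OF card_short_tie_sequences])
  apply (rule conjI)
  subgoal
    by (simp only: tie_knots rolfsen_table_def list.set image_insert image_empty fst_conv prod.case)
  subgoal
    using sequences_of_type_certified
    by (simp only: certificates_defs append.simps list.set ball_simps image_insert image_empty
        fst_conv prod.case simp_thms)
  done

end
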